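(* Let $T \in \Sigma^n$, let $A$ be its suffix array, $A^d$ its differential suffix array, and let $u_1 < u_2 < \dots < u_r$ be the suffix array values at the starting positions of the $r$ runs of the Burrows–Wheeler transform of $T$, with $u_{r+1} := n+1$. (i) Given the list $I_\Phi = (u_1,\Phi(u_1)),\dots,(u_r,\Phi(u_r))$, the number of occurrences in $A^d$ of every distinct value of $A^d$ can be computed in $O(r)$ expected time and $O(r)$ space. (ii) There are at most $r+1$ distinct values in $A^d$.
   Context: The suffix array $A$ of $T$ lists the starting positions of the suffixes of $T$ in lexicographic order. The differential suffix array is $A^d[1]:=A[1]$, $A^d[i]:=A[i]-A[i-1]$ for $i\in[2,n]$. The Burrows–Wheeler transform (BWT) of $T$ is $L[i] := T[A[i]-1]$ if $A[i]>1$ and $L[i]:=T[n]$ if $A[i]=1$; a run is a maximal block of equal consecutive characters in $L$, $r$ is the number of runs, and $l_1,\dots,l_r$ are the starting positions of the runs; $\{u_1,\dots,u_r\} = \{A[l_1],\dots,A[l_r]\}$ sorted increasingly. The function $\Phi:[1,n]\to[1,n]$ is defined by $\Phi(A[i]) = A[i-1]$ for $i\in[2,n]$ and $\Phi(A[1]) = A[n]$. Model: word RAM (expected time refers to randomized hashing).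
   Formalization: The text T is assumed to end with a sentinel smaller than all its other characters; without this (ii) fails for T = babbb (r = 2, four distinct values in A^d), and (i) fails since "ab" and "ba" have the same I_Φ but different A^d. *)

theory Defs
  imports "HOL-Probability.Probability" "HOL-Library.List_Lexorder"
begin

unbundle bit_operations_syntax

section \<open>Suffix array, Burrows--Wheeler transform and the function Phi\<close>

text \<open>
  Texts are lists over a linearly ordered alphabet; all positions in texts and arrays are
  1-based, so the character \<open>T[k]\<close> is \<open>T ! (k - 1)\<close>.
  The order on lists is the lexicographic one of \<^theory>\<open>HOL-Library.List_Lexorder\<close>, in which a
  proper prefix is smaller.
\<close>

text \<open>
  The usual convention in this setting: the text ends with a sentinel that is smaller than every
  other character of the text (so it occurs exactly once, and the text is nonempty).
  The run-based results are false for arbitrary texts: already \<open>T = babbb\<close> has 2 runs and 4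
  distinct differential values.
\<close>

definition sentinel_terminated :: "'a::linorder list \<Rightarrow> bool" where
  "sentinel_terminated T \<longleftrightarrow> T \<noteq> [] \<and> (\<forall>x \<in> set (butlast T). last T < x)"

definition suffix_array :: "'a::linorder list \<Rightarrow> nat list" where
  "suffix_array T = sort_key (\<lambda>i. drop (i - 1) T) [1..<length T + 1]"

definition SA :: "'a::linorder list \<Rightarrow> nat \<Rightarrow> nat" where
  "SA T i = suffix_array T ! (i - 1)"

definition diff_suffix_array :: "'a::linorder list \<Rightarrow> int list" where
  "diff_suffix_array T =
     map (\<lambda>i. if i = 1 then int (SA T 1) else int (SA T i) - int (SA T (i - 1)))
       [1..<length T + 1]"

definition bwt :: "'a::linorder list \<Rightarrow> nat \<Rightarrow> 'a" where
  "bwt T i = (if SA T i > 1 then T ! (SA T i - 1 - 1) else T ! (length T - 1))"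

text \<open>The runs, as pairs of their first and last positions.\<close>

definition bwt_runs :: "'a::linorder list \<Rightarrow> (nat \<times> nat) set" where
  "bwt_runs T = {(i, j). 1 \<le> i \<and> i \<le> j \<and> j \<le> length T
     \<and> (\<forall>k \<in> {i..j}. bwt T k = bwt T i)
     \<and> (i = 1 \<or> bwt T (i - 1) \<noteq> bwt T i)
     \<and> (j = length T \<or> bwt T (j + 1) \<noteq> bwt T i)}"

definition num_runs :: "'a::linorder list \<Rightarrow> nat" where
  "num_runs T = card (bwt_runs T)"

definition run_start_values :: "'a::linorder list \<Rightarrow> nat list" where
  "run_start_values T = sorted_list_of_set ((\<lambda>(i, j). SA T i) ` bwt_runs T)"

definition Phi :: "'a::linorder list \<Rightarrow> nat \<Rightarrow> nat" where
  "Phi T p = (let i = (THE i. i \<in> {1..length T} \<and> SA T i = p)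
              in if i = 1 then SA T (length T) else SA T (i - 1))"

definition I_Phi :: "'a::linorder list \<Rightarrow> (nat \<times> nat) list" where
  "I_Phi T = map (\<lambda>u. (u, Phi T u)) (run_start_values T)"


section \<open>A randomized word RAM\<close>

text \<open>
  Words of \<open>w\<close> bits are represented by the natural numbers below \<open>2 ^ w\<close>. A program is a list of
  instructions that work on registers and on a memory addressed by words. It mentions only
  finitely many registers, so the registers contribute a constant to the space. Each instruction
  takes one time step. The machine halts when the program counter leaves the program.
\<close>

datatype binop = Add | Sub | Mul | Div | Mod | And | Or | Xor | Shl | Shr

datatype instr =
    Const nat nat
  | Op binop nat nat nat
  | Load nat nat
  | Store nat nat
  | Rand nat
  | Jump nat
  | JumpEq nat nat nat
  | JumpLess nat nat nat

fun alu :: "nat \<Rightarrow> binop \<Rightarrow> nat \<Rightarrow> nat \<Rightarrow> nat" where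
  "alu w Add x y = (x + y) mod 2 ^ w"
| "alu w Sub x y = (x + (2 ^ w - y)) mod 2 ^ w"
| "alu w Mul x y = (x * y) mod 2 ^ w"
| "alu w Div x y = x div y"
| "alu w Mod x y = x mod y"
| "alu w And x y = x AND y"
| "alu w Or x y = x OR y"
| "alu w Xor x y = x XOR y"
| "alu w Shl x y = push_bit y x mod 2 ^ w"
| "alu w Shr x y = drop_bit y x"

text \<open>\<open>tape\<close> is the stream of random words not yet consumed by the instruction \<open>Rand\<close>.\<close>

record config =
  pc :: nat
  regs :: "nat \<Rightarrow> nat"
  mem :: "nat \<Rightarrow> nat"
  tape :: "nat stream"

definition halted :: "instr list \<Rightarrow> config \<Rightarrow> bool" where
  "halted P c \<longleftrightarrow> length P \<le> pc c"

fun exec_instr :: "nat \<Rightarrow> instr \<Rightarrow> config \<Rightarrow> config" where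
  "exec_instr w (Const a n) c = c\<lparr>pc := pc c + 1, regs := (regs c)(a := n mod 2 ^ w)\<rparr>"
| "exec_instr w (Op f a b d) c =
     c\<lparr>pc := pc c + 1, regs := (regs c)(a := alu w f (regs c b) (regs c d))\<rparr>"
| "exec_instr w (Load a b) c = c\<lparr>pc := pc c + 1, regs := (regs c)(a := mem c (regs c b))\<rparr>"
| "exec_instr w (Store a b) c = c\<lparr>pc := pc c + 1, mem := (mem c)(regs c a := regs c b)\<rparr>"
| "exec_instr w (Rand a) c =
     c\<lparr>pc := pc c + 1, regs := (regs c)(a := shd (tape c)), tape := stl (tape c)\<rparr>"
| "exec_instr w (Jump l) c = c\<lparr>pc := l\<rparr>"
| "exec_instr w (JumpEq a b l) c =
     c\<lparr>pc := (if regs c a = regs c b then l else pc c + 1)\<rparr>"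
| "exec_instr w (JumpLess a b l) c =
     c\<lparr>pc := (if regs c a < regs c b then l else pc c + 1)\<rparr>"

definition step :: "nat \<Rightarrow> instr list \<Rightarrow> config \<Rightarrow> config" where
  "step w P c = (if halted P c then c else exec_instr w (P ! pc c) c)"

definition run :: "nat \<Rightarrow> instr list \<Rightarrow> config \<Rightarrow> nat \<Rightarrow> config" where
  "run w P c t = (step w P ^^ t) c"

text \<open>The infimum over the empty set is \<open>\<infinity>\<close>, the running time of a diverging computation.\<close>

definition running_time :: "nat \<Rightarrow> instr list \<Rightarrow> config \<Rightarrow> ennreal" where
  "running_time w P c = (INF t \<in> {t. halted P (run w P c t)}. of_nat t)"

fun accessed_by :: "instr \<Rightarrow> config \<Rightarrow> nat set" where
  "accessed_by (Load a b) c = {regs c b}"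
| "accessed_by (Store a b) c = {regs c a}"
| "accessed_by _ c = {}"

text \<open>
  Space \<open>s\<close> means that every memory access of the computation is to one of the first \<open>s\<close> memory
  cells. Input and output start at cell 0.
\<close>

definition runs_in_space :: "nat \<Rightarrow> instr list \<Rightarrow> config \<Rightarrow> nat \<Rightarrow> bool" where
  "runs_in_space w P c s \<longleftrightarrow>
     (\<forall>t. \<not> halted P (run w P c t) \<longrightarrow>
        accessed_by (P ! pc (run w P c t)) (run w P c t) \<subseteq> {..<s})"

text \<open>The random words are independent and uniformly distributed.\<close>

definition random_tapes :: "nat \<Rightarrow> nat stream measure" where
  "random_tapes w = stream_space (uniform_count_measure {..<2 ^ w})"

text \<open>
  A list of pairs is passed to a program by storing its length in cell 0, followed by the
  components of the pairs. All other cells and all registers are initially 0.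
\<close>

definition encode_pairs :: "(nat \<times> nat) list \<Rightarrow> nat list" where
  "encode_pairs ps = length ps # concat (map (\<lambda>(x, y). [x, y]) ps)"

definition initial_config :: "(nat \<times> nat) list \<Rightarrow> nat stream \<Rightarrow> config" where
  "initial_config ps \<omega> =
     \<lparr>pc = 0, regs = (\<lambda>_. 0),
      mem = (\<lambda>a. if a < length (encode_pairs ps) then encode_pairs ps ! a else 0),
      tape = \<omega>\<rparr>"

text \<open>
  The result has the same layout. The first component of each pair is a possibly negative
  number in two's complement.
\<close>

definition output_pairs :: "nat \<Rightarrow> config \<Rightarrow> (int \<times> nat) list" where
  "output_pairs w c =
     map (\<lambda>k. (signed_take_bit (w - 1) (int (mem c (2 * k + 1))), mem c (2 * k + 2)))
       [0..<mem c 0]"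

end

theory Submission
  imports Defs "HOL-Number_Theory.Cong"
begin

text \<open>
  If \<open>p + 1\<close> is not the suffix array value of a run start, then its suffix and the preceding one in
  the suffix array are extended to the left by the same character, so \<open>\<Phi>(p + 1) = \<Phi>(p) + 1\<close>. Hence
  \<open>p - \<Phi>(p)\<close> is constant on every segment \<open>[u\<^sub>i, u\<^sub>i\<^sub>+\<^sub>1)\<close>, and the sentinel gives \<open>u\<^sub>1 = 1\<close> and
  \<open>u\<^sub>r = n = A[1]\<close>. So \<open>A\<^sup>d\<close> consists of one entry \<open>n\<close> and of \<open>u\<^sub>i\<^sub>+\<^sub>1 - u\<^sub>i\<close> copies of \<open>u\<^sub>i - \<Phi>(u\<^sub>i)\<close> for
  \<open>i < r\<close>, and it remains to add up weights of equal keys. A program does this with a chained hash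
  table with \<open>r\<close> buckets. The hash function maps \<open>x\<close> to \<open>(a x mod 2\<^sup>w) div D\<close>, where \<open>a\<close> is a random
  odd word and \<open>D\<close> is about \<open>2\<^sup>w / r\<close>; two distinct keys collide with probability at most
  \<open>4 D / 2\<^sup>w\<close>, so the expected length of a chain is constant.
\<close>

section \<open>Collisions of multiplicative hashing\<close>

text \<open>
  Write \<open>z = 2\<^sup>s y\<close> with \<open>y\<close> odd and \<open>M = 2\<^sup>w\<^sup>-\<^sup>s\<close>. The multiplier \<open>b\<close> is determined by
  \<open>v = b y mod M\<close> and \<open>q = b div M < 2\<^sup>s\<close>. Since \<open>b z mod 2\<^sup>w = 2\<^sup>s v\<close> and \<open>v\<close> is odd, hence positive,
  the number \<open>2\<^sup>s (v - 1) + q\<close> encodes \<open>b\<close> injectively below \<open>D\<close>.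
\<close>

lemma card_odd_multipliers_small:
  fixes z D w :: nat
  assumes z: "0 < z" "z < 2 ^ w"
  shows "card {b. b < 2 ^ w \<and> odd b \<and> b * z mod 2 ^ w < D} \<le> D"
proof -
  define s where "s = multiplicity 2 z"
  obtain y where zy: "z = 2 ^ s * y" and oy: "odd y"
    using multiplicity_decompose'[of z 2] z(1) unfolding s_def by auto
  have "2 ^ s \<le> z" using zy oy z(1) by (cases y) auto
  then have "(2::nat) ^ s < 2 ^ w" using z(2) by (rule le_less_trans)
  then have sw: "s < w" by simp
  define M :: nat where "M = 2 ^ (w - s)"
  have W: "(2::nat) ^ w = 2 ^ s * M" using sw by (simp add: M_def flip: power_add)
  have evM: "even M" using sw by (simp add: M_def)
  have cop: "coprime y M" using oy by (simp add: M_def)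
  have Mpos: "0 < M" by (simp add: M_def)
  let ?B = "{b. b < 2 ^ w \<and> odd b \<and> b * z mod 2 ^ w < D}"
  let ?f = "\<lambda>b. 2 ^ s * (b * y mod M - 1) + b div M"
  have pos: "0 < b * y mod M" if "odd b" for b
  proof -
    have "odd (b * y mod M)" using that oy evM by (simp add: dvd_mod_iff)
    then show ?thesis by (rule odd_pos)
  qed
  have q: "b div M < 2 ^ s" if "b < 2 ^ w" for b
    using that Mpos by (simp add: W less_mult_imp_div_less)
  have "?f ` ?B \<subseteq> {..<D}"
  proof (clarsimp)
    fix b assume b: "b < 2 ^ w" "odd b" "b * z mod 2 ^ w < D"
    have "b * z mod 2 ^ w = 2 ^ s * (b * y mod M)"
      unfolding zy W by (metis mult.left_commute mult_mod_right)
    moreover have "2 ^ s * (b * y mod M) = 2 ^ s * (b * y mod M - 1) + 2 ^ s"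
      using pos[OF b(2)] by (cases "b * y mod M") auto
    ultimately show "2 ^ s * (b * y mod M - Suc 0) + b div M < D" using q[OF b(1)] b(3) by simp
  qed
  moreover have "inj_on ?f ?B"
  proof (rule inj_onI)
    fix b c assume b: "b \<in> ?B" and c: "c \<in> ?B" and eq: "?f b = ?f c"
    have "?f b mod 2 ^ s = ?f c mod 2 ^ s" "?f b div 2 ^ s = ?f c div 2 ^ s" using eq by simp_all
    then have 1: "b div M = c div M" and 2: "b * y mod M - 1 = c * y mod M - 1"
      using b c q by auto
    have "b * y mod M = c * y mod M" using 2 pos[of b] pos[of c] b c by simp
    then have "[b * y = c * y] (mod M)" by (simp add: cong_def)
    then have "[b = c] (mod M)" using cop cong_mult_rcancel_nat by blast
    then show "b = c" using 1 by (metis cong_def div_mult_mod_eq)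
  qed
  ultimately have "card ?B \<le> card {..<D}" by (intro card_inj_on_le) auto
  then show ?thesis by simp
qed

text \<open>
  The two residues of a collision differ by less than \<open>D\<close>, so \<open>b (y - x)\<close> or \<open>- b (y - x)\<close> is
  less than \<open>D\<close> modulo \<open>2\<^sup>w\<close>.
\<close>

lemma card_odd_multipliers_collide:
  fixes x y D w :: nat
  assumes "x < y" "y < 2 ^ w" "0 < D"
  shows "card {b. b < 2 ^ w \<and> odd b \<and> (b * x mod 2 ^ w) div D = (b * y mod 2 ^ w) div D} \<le> 2 * D"
proof -
  define z where "z = y - x"
  define W :: nat where "W = 2 ^ w"
  have z: "0 < z" "z < W" using assms by (auto simp: z_def W_def)
  have w: "0 < w" using assms by (cases w) auto
  let ?A = "{b. b < W \<and> odd b \<and> b * z mod W < D}"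
  let ?B = "{b. b < W \<and> odd b \<and> (b * x mod W) div D = (b * y mod W) div D}"
  have evW: "even W" and Wpos: "0 < W" using w by (auto simp: W_def)
  have "?B \<subseteq> ?A \<union> (\<lambda>b. W - b) ` ?A"
  proof
    fix b assume b: "b \<in> ?B"
    define p where "p = b * x mod W"
    define q where "q = b * y mod W"
    have pq: "p div D = q div D" and bW: "b < W" "odd b" using b by (auto simp: p_def q_def)
    have pqW: "p < W" "q < W" using Wpos by (auto simp: p_def q_def)
    have byz: "b * y = b * x + b * z" using assms by (simp add: z_def flip: distrib_left)
    have d: "p < q + D" "q < p + D"
      using div_mult_mod_eq[of p D] div_mult_mod_eq[of q D] mod_less_divisor[OF assms(3), of p]
        mod_less_divisor[OF assms(3), of q] unfolding pq by linarith+
    have qq: "q = (p + b * z) mod W" by (simp add: q_def p_def byz mod_add_left_eq)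
    show "b \<in> ?A \<union> (\<lambda>b. W - b) ` ?A"
    proof (cases "p \<le> q")
      case True
      have "(p + b * z mod W) mod W = (p + (q - p)) mod W"
        using qq pqW True by (simp add: mod_add_right_eq)
      then have "[p + b * z mod W = p + (q - p)] (mod W)" by (simp add: cong_def)
      then have "[b * z mod W = q - p] (mod W)" using cong_add_lcancel_nat by blast
      then have "b * z mod W = q - p" using pqW by (simp add: cong_def)
      then have "b \<in> ?A" using bW d True by auto
      then show ?thesis by blast
    next
      case False
      \<comment> \<open>\<open>W - b\<close> stands for \<open>- b\<close> modulo \<open>W\<close>;
        it is again odd because \<open>W\<close> is even.\<close>
      have "(q + (W - b) * z) mod W = (p + b * z + (W - b) * z) mod W"
        unfolding qq by (simp add: mod_add_left_eq)
      also have "p + b * z + (W - b) * z = p + W * z"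
        using bW by (simp add: add.assoc flip: distrib_right)
      also have "\<dots> mod W = p" using pqW by simp
      finally have "(q + (W - b) * z mod W) mod W = (q + (p - q)) mod W"
        using pqW False by (simp add: mod_add_right_eq)
      then have "[q + (W - b) * z mod W = q + (p - q)] (mod W)" by (simp add: cong_def)
      then have "[(W - b) * z mod W = p - q] (mod W)" using cong_add_lcancel_nat by blast
      then have "(W - b) * z mod W = p - q" using pqW by (simp add: cong_def)
      moreover have "0 < b" using bW(2) by (rule odd_pos)
      ultimately have "W - b \<in> ?A" using bW d False evW by auto
      then have "W - (W - b) \<in> (\<lambda>b. W - b) ` ?A" by blast
      then show ?thesis using bW by simp
    qed
  qed
  then have "card ?B \<le> card (?A \<union> (\<lambda>b. W - b) ` ?A)" by (intro card_mono) auto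
  also have "\<dots> \<le> card ?A + card ((\<lambda>b. W - b) ` ?A)" by (rule card_Un_le)
  also have "\<dots> \<le> card ?A + card ?A" by (intro add_left_mono card_image_le) auto
  also have "\<dots> \<le> 2 * D" using card_odd_multipliers_small[of z w D] z by (simp add: W_def)
  finally show ?thesis by (simp add: W_def)
qed

text \<open>Setting the lowest bit makes every word an admissible odd multiplier, so a single random
  word selects the function.\<close>

definition hash :: "nat \<Rightarrow> nat \<Rightarrow> nat \<Rightarrow> nat \<Rightarrow> nat" where
  "hash w D a x = ((a OR 1) * x mod 2 ^ w) div D"

lemma or_one_less:
  fixes a :: nat
  assumes "a < 2 ^ w" "0 < w" shows "a OR 1 < 2 ^ w"
proof -
  have "take_bit w (a OR 1) = a OR 1"
    using assms by (simp add: take_bit_or take_bit_nat_eq_self)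
  then show ?thesis by (metis take_bit_nat_less_exp)
qed

text \<open>An odd multiplier \<open>b\<close> arises from the two words \<open>b\<close> and
  \<open>b - 1\<close>, so the bound \<open>2 * D\<close> for odd multipliers doubles.\<close>

lemma card_hash_collide:
  assumes "x \<noteq> y" "x < 2 ^ w" "y < 2 ^ w" "0 < D"
  shows "card {a. a < 2 ^ w \<and> hash w D a x = hash w D a y} \<le> 4 * D"
proof -
  let ?A = "{a. a < 2 ^ w \<and> hash w D a x = hash w D a y}"
  let ?B = "{b. b < 2 ^ w \<and> odd b \<and> (b * x mod 2 ^ w) div D = (b * y mod 2 ^ w) div D}"
  have w: "0 < w" using assms by (cases w) auto
  have "?A \<subseteq> ?B \<union> (\<lambda>b. b - 1) ` ?B"
  proof
    fix a assume a: "a \<in> ?A"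
    define c where "c = a OR 1"
    have "c \<in> ?B" using a or_one_less[of a w] w by (simp add: c_def hash_def even_or_iff)
    moreover have "a = c \<or> a = c - 1" unfolding c_def by (cases "even a") (simp_all add: or_Suc_0_eq)
    ultimately show "a \<in> ?B \<union> (\<lambda>b. b - 1) ` ?B" by blast
  qed
  then have "card ?A \<le> card (?B \<union> (\<lambda>b. b - 1) ` ?B)" by (intro card_mono) auto
  also have "\<dots> \<le> card ?B + card ((\<lambda>b. b - 1) ` ?B)" by (rule card_Un_le)
  also have "\<dots> \<le> card ?B + card ?B" by (intro add_left_mono card_image_le) auto
  also have "card ?B \<le> 2 * D"
  proof (cases "x < y")
    case True
    then show ?thesis using card_odd_multipliers_collide assms by blast
  next
    case False
    then have "y < x" using assms by simp
    from card_odd_multipliers_collide[OF this] show ?thesis using assms by (simp add: eq_commute)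
  qed
  finally show ?thesis by simp
qed

section \<open>Runs and the differential suffix array\<close>

locale suffix_sorted =
  fixes T :: "'a::linorder list"
  assumes sentinel: "sentinel_terminated T"
begin

section \<open>Suffix order, suffix array and Phi\<close>

abbreviation n :: nat where "n \<equiv> length T"
abbreviation suf :: "nat \<Rightarrow> 'a list" where "suf p \<equiv> drop (p - 1) T"

lemma n_pos: "0 < n"
  using sentinel by (simp add: sentinel_terminated_def)

lemma nth_last: "T ! (n - 1) = last T"
  using n_pos by (simp add: last_conv_nth)

lemma last_less_nth: "k < n - 1 \<Longrightarrow> last T < T ! k"
  using sentinel by (simp add: sentinel_terminated_def nth_butlast[symmetric])

lemma suf_Cons: "1 \<le> p \<Longrightarrow> p \<le> n \<Longrightarrow> suf p = T ! (p - 1) # suf (p + 1)"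
  using Cons_nth_drop_Suc[of "p - 1" T] by simp

lemma SA_bij: "bij_betw (SA T) {1..n} {1..n}"
proof -
  let ?f = "\<lambda>i. suffix_array T ! i"
  have s: "set (suffix_array T) = {1..n}" and l: "length (suffix_array T) = n"
    using n_pos by (auto simp: suffix_array_def Suc_le_eq)
  have "distinct (suffix_array T)"
    unfolding suffix_array_def by (rule mset_eq_imp_distinct_iff[THEN iffD1, OF mset_sort[symmetric]]) simp
  then have "bij_betw ?f {..<n} {1..n}" using s l by (metis bij_betw_nth)
  moreover have "bij_betw (\<lambda>i. i - 1) {1..n} {..<n}"
    by (rule bij_betw_byWitness[where f' = Suc]) auto
  ultimately have "bij_betw (?f \<circ> (\<lambda>i. i - 1)) {1..n} {1..n}" by (rule bij_betw_trans[rotated])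
  then show ?thesis by (simp add: SA_def[abs_def] comp_def)
qed

lemma SA_range: "1 \<le> i \<Longrightarrow> i \<le> n \<Longrightarrow> 1 \<le> SA T i \<and> SA T i \<le> n"
  using SA_bij by (fastforce simp: bij_betw_def)

lemma SA_inj: "\<lbrakk>SA T i = SA T j; 1 \<le> i; i \<le> n; 1 \<le> j; j \<le> n\<rbrakk> \<Longrightarrow> i = j"
  using SA_bij unfolding bij_betw_def inj_on_def by auto

lemma SA_surj: assumes "1 \<le> p" "p \<le> n" obtains i where "1 \<le> i" "i \<le> n" "SA T i = p"
proof -
  have "p \<in> SA T ` {1..n}" using SA_bij assms by (simp add: bij_betw_def)
  then show ?thesis using that by auto
qed

lemma suf_eq: "\<lbrakk>suf p = suf q; 1 \<le> p; p \<le> n; 1 \<le> q; q \<le> n\<rbrakk> \<Longrightarrow> p = q"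
  by (drule arg_cong[where f = length]) auto

lemma suf_SA_less:
  assumes "1 \<le> i" "i < j" "j \<le> n"
  shows "suf (SA T i) < suf (SA T j)"
proof -
  let ?s = "map suf (suffix_array T)"
  have "sorted ?s" unfolding suffix_array_def by (rule sorted_sort_key)
  moreover have "length ?s = n" using n_pos by (simp add: suffix_array_def Suc_le_eq)
  ultimately have "?s ! (i - 1) \<le> ?s ! (j - 1)" using assms by (intro sorted_nth_mono) auto
  then have "suf (SA T i) \<le> suf (SA T j)"
    using assms \<open>length ?s = n\<close> by (simp add: SA_def)
  moreover have "suf (SA T i) \<noteq> suf (SA T j)"
  proof
    assume "suf (SA T i) = suf (SA T j)"
    then have "SA T i = SA T j" using SA_range[of i] SA_range[of j] assms by (intro suf_eq) auto
    then show False using SA_inj[of i j] assms by simp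
  qed
  ultimately show ?thesis by simp
qed

lemma suf_SA_less_iff:
  assumes "1 \<le> i" "i \<le> n" "1 \<le> j" "j \<le> n"
  shows "suf (SA T i) < suf (SA T j) \<longleftrightarrow> i < j"
  using suf_SA_less[of i j] suf_SA_less[of j i] assms by (metis less_asym linorder_neqE_nat less_irrefl)

text \<open>The suffix at \<open>n\<close> is the sentinel alone, and every other suffix starts with
  a larger character.\<close>

lemma SA_1: "SA T 1 = n"
proof (rule ccontr)
  assume ne: "SA T 1 \<noteq> n"
  obtain i where i: "1 \<le> i" "i \<le> n" "SA T i = n" using SA_surj[of n] n_pos by auto
  then have "1 < i" using ne by (cases "i = 1") auto
  then have "suf (SA T 1) < suf n" using suf_SA_less[of 1 i] i by simp
  moreover have "SA T 1 < n" "1 \<le> SA T 1" using SA_range[of 1] n_pos ne by auto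
  ultimately show False
    using last_less_nth[of "SA T 1 - 1"] suf_Cons[of "SA T 1"] suf_Cons[of n] nth_last n_pos
    by (auto simp: diff_less_mono)
qed

lemma Phi_SA: "2 \<le> i \<Longrightarrow> i \<le> n \<Longrightarrow> Phi T (SA T i) = SA T (i - 1)"
proof -
  assume i: "2 \<le> i" "i \<le> n"
  have "(THE j. j \<in> {1..n} \<and> SA T j = SA T i) = i"
    using i SA_inj by (intro the_equality) auto
  then show ?thesis using i by (simp add: Phi_def Let_def)
qed

lemma Phi_range:
  assumes "1 \<le> p" "p \<le> n" shows "1 \<le> Phi T p \<and> Phi T p \<le> n"
proof -
  obtain i where i: "1 \<le> i" "i \<le> n" "SA T i = p" using SA_surj assms by blast
  have "(THE j. j \<in> {1..n} \<and> SA T j = p) = i"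
    using i SA_inj by (intro the_equality) auto
  then show ?thesis using i SA_range[of n] SA_range[of "i - 1"] n_pos by (auto simp: Phi_def Let_def)
qed

text \<open>Rows are ordered like suffixes, so a row strictly between those of \<open>q\<close> and
  \<open>p\<close> would yield a forbidden suffix. This determines \<open>Phi\<close> without naming
  rows.\<close>

lemma Phi_eqI:
  assumes "1 \<le> p" "p \<le> n" "1 \<le> q" "q \<le> n" "suf q < suf p"
    and gap: "\<And>x. \<lbrakk>1 \<le> x; x \<le> n; suf q < suf x\<rbrakk> \<Longrightarrow> \<not> suf x < suf p"
  shows "Phi T p = q"
proof -
  obtain i where i: "1 \<le> i" "i \<le> n" "SA T i = p" using SA_surj assms by blast
  obtain j where j: "1 \<le> j" "j \<le> n" "SA T j = q" using SA_surj assms by blast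
  have ji: "j < i" using suf_SA_less_iff[of j i] i j assms by simp
  have "\<not> j + 1 < i"
    using gap[of "SA T (j + 1)"] SA_range[of "j + 1"] suf_SA_less[of j "j + 1"] suf_SA_less[of "j + 1" i] i j
    by auto
  then have "i = j + 1" using ji by simp
  then show ?thesis using Phi_SA[of i] i j by simp
qed

section \<open>Runs of the BWT and the suffix array values at their starts\<close>

lemma bwt_run_from:
  assumes "1 \<le> i" "i \<le> n" "i = 1 \<or> bwt T (i - 1) \<noteq> bwt T i"
  obtains j where "(i, j) \<in> bwt_runs T"
proof -
  \<comment> \<open>The run extends to the largest \<open>j\<close> in this set; maximality forces a
    different character after it.\<close>
  define J where "J = {j \<in> {i..n}. \<forall>k \<in> {i..j}. bwt T k = bwt T i}"
  have J: "finite J" "i \<in> J" using assms by (auto simp: J_def)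
  define j where "j = Max J"
  have "j \<in> J" unfolding j_def using J by (intro Max_in) auto
  then have jn: "j \<in> {i..n}" and const: "\<And>k. k \<in> {i..j} \<Longrightarrow> bwt T k = bwt T i"
    unfolding J_def by blast+
  from jn have j: "i \<le> j" "j \<le> n" by simp_all
  have "j = n \<or> bwt T (j + 1) \<noteq> bwt T i"
  proof (rule ccontr)
    assume a: "\<not> ?thesis"
    have "bwt T k = bwt T i" if "k \<in> {i..j + 1}" for k
    proof (cases "k = j + 1")
      case True
      then show ?thesis using a by blast
    next
      case False
      then show ?thesis using that by (intro const) auto
    qed
    moreover have "j + 1 \<in> {i..n}" using a j by auto
    ultimately have "j + 1 \<in> J" unfolding J_def by blast
    then have "j + 1 \<le> j" unfolding j_def using J by (intro Max_ge) auto
    then show False by simp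
  qed
  then have "(i, j) \<in> bwt_runs T" using assms j const unfolding bwt_runs_def by blast
  then show ?thesis by (rule that)
qed

lemma bwt_runs_unique: "(i, j) \<in> bwt_runs T \<Longrightarrow> (i, k) \<in> bwt_runs T \<Longrightarrow> j = k"
proof (induction j k rule: linorder_wlog)
  case (le j k)
  show ?case
  proof (rule ccontr)
    assume "j \<noteq> k"
    have *: "i \<le> j" "k \<le> n" "j = n \<or> bwt T (j + 1) \<noteq> bwt T i"
        "\<forall>l \<in> {i..k}. bwt T l = bwt T i"
      using le unfolding bwt_runs_def by blast+
    have "j + 1 \<in> {i..k}" "j \<noteq> n" using le(1) *(1,2) \<open>j \<noteq> k\<close> by simp_all
    then show False using * by blast
  qed
qed simp

abbreviation us :: "nat list" where "us \<equiv> run_start_values T"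

lemma bwt_runs_subset: "bwt_runs T \<subseteq> {1..n} \<times> {1..n}"
proof (rule subrelI)
  fix i j assume "(i, j) \<in> bwt_runs T"
  then have "1 \<le> i" "i \<le> j" "j \<le> n" unfolding bwt_runs_def by blast+
  then show "(i, j) \<in> {1..n} \<times> {1..n}" by simp
qed

lemma finite_bwt_runs: "finite (bwt_runs T)"
  using bwt_runs_subset by (rule finite_subset) simp

lemma set_us: "set us = (\<lambda>(i, j). SA T i) ` bwt_runs T"
  using finite_bwt_runs by (simp add: run_start_values_def)

text \<open>A start position determines its run and \<open>SA T\<close> is injective, so passing to
  the set of values loses no run.\<close>

lemma length_us: "length us = num_runs T"
proof -
  have "inj_on (\<lambda>(i, j). SA T i) (bwt_runs T)"
  proof (rule inj_onI, clarify)
    fix i j i' j' assume *: "(i, j) \<in> bwt_runs T" "(i', j') \<in> bwt_runs T" "SA T i = SA T i'"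
    then have "i \<in> {1..n}" "i' \<in> {1..n}" using bwt_runs_subset by blast+
    then have "i = i'" using SA_inj[of i i'] *(3) by simp
    then show "i = i' \<and> j = j'" using bwt_runs_unique * by blast
  qed
  then show ?thesis by (simp add: run_start_values_def num_runs_def card_image)
qed

lemma sorted_us: "sorted_wrt (<) us"
  by (simp add: run_start_values_def)

lemma us_range: "u \<in> set us \<Longrightarrow> 1 \<le> u \<and> u \<le> n"
proof -
  assume "u \<in> set us"
  then obtain i j where ij: "(i, j) \<in> bwt_runs T" "u = SA T i" unfolding set_us by force
  then have "i \<in> {1..n}" using bwt_runs_subset by blast
  then show ?thesis using SA_range[of i] ij by simp
qed

lemma SA_in_us:
  assumes "1 \<le> i" "i \<le> n" "i = 1 \<or> bwt T (i - 1) \<noteq> bwt T i"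
  shows "SA T i \<in> set us"
proof -
  obtain j where "(i, j) \<in> bwt_runs T" using bwt_run_from[OF assms] by blast
  then show ?thesis unfolding set_us by force
qed

lemma n_in_us: "n \<in> set us"
  using SA_in_us[of 1] SA_1 n_pos by simp

text \<open>The row of the suffix \<open>1\<close> is the only one whose BWT character is the sentinel.\<close>

lemma one_in_us: "1 \<in> set us"
proof -
  obtain i where i: "1 \<le> i" "i \<le> n" "SA T i = 1" using SA_surj[of 1] n_pos by auto
  have "bwt T (i - 1) \<noteq> bwt T i" if "i \<noteq> 1"
  proof -
    have "SA T (i - 1) \<noteq> 1"
    proof
      assume *: "SA T (i - 1) = 1"
      have "i - 1 = i" by (rule SA_inj) (use i that * in auto)
      then show False using i by simp
    qed
    moreover have "1 \<le> SA T (i - 1)" "SA T (i - 1) \<le> n" using SA_range[of "i - 1"] i that by auto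
    ultimately have "SA T (i - 1) - 1 - 1 < n - 1" and "1 < SA T (i - 1)" by linarith+
    from last_less_nth[OF this(1)] this(2) show ?thesis using i nth_last by (auto simp: bwt_def)
  qed
  then show ?thesis using SA_in_us[of i] i by auto
qed

text \<open>Prepending a common character keeps two suffixes adjacent: a suffix strictly between the
  extended ones would start with the same character, and dropping it would leave a suffix strictly
  between two neighbouring rows.\<close>

lemma Phi_Suc:
  assumes p: "1 \<le> p" "p + 1 < n" and notin: "p + 1 \<notin> set us"
  shows "Phi T (p + 1) = Phi T p + 1"
proof -
  obtain i where i: "1 \<le> i" "i \<le> n" "SA T i = p + 1" using SA_surj[of "p + 1"] p by auto
  have i1: "i \<noteq> 1" using i SA_1 p by auto
  define q where "q = SA T (i - 1)"
  have q: "1 \<le> q" "q \<le> n" using SA_range[of "i - 1"] i i1 by (auto simp: q_def)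
  have Phi: "Phi T (p + 1) = q" using Phi_SA[of i] i i1 by (simp add: q_def)
  have "bwt T (i - 1) = bwt T i" using SA_in_us[of i] i notin by auto
  then have eq: "(if 1 < q then T ! (q - 1 - 1) else last T) = T ! (p - 1)"
    using i p nth_last by (auto simp: bwt_def q_def split: if_splits)
  have "p - 1 < n - 1" using p by linarith
  then have last_less: "last T < T ! (p - 1)" by (rule last_less_nth)
  \<comment> \<open>For \<open>q = 1\<close> the BWT character of row \<open>i - 1\<close> would be
    the sentinel, but it is the larger \<open>T ! (p - 1)\<close>.\<close>
  have q1: "1 < q" using eq last_less by (auto split: if_splits)
  have sq: "suf (q - 1) = T ! (p - 1) # suf q" using suf_Cons[of "q - 1"] q q1 eq by simp
  have sp: "suf p = T ! (p - 1) # suf (p + 1)" using suf_Cons[of p] p by simp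
  have lt: "suf q < suf (p + 1)" using suf_SA_less[of "i - 1" i] i i1 by (simp add: q_def)
  have "Phi T p = q - 1"
  proof (rule Phi_eqI)
    show "suf (q - 1) < suf p" unfolding sq sp using lt by simp
  next
    fix x assume x: "1 \<le> x" "x \<le> n" "suf (q - 1) < suf x"
    show "\<not> suf x < suf p"
    proof
      assume "suf x < suf p"
      with x have c: "T ! (x - 1) = T ! (p - 1)" and b: "suf q < suf (x + 1)" "suf (x + 1) < suf (p + 1)"
        unfolding sq sp using suf_Cons[of x] by auto
      \<comment> \<open>The suffix \<open>x\<close> starts with a character above the sentinel, so
        \<open>x + 1\<close> is still a position and has a row.\<close>
      have "x \<noteq> n" using c last_less nth_last by auto
      then obtain j where j: "1 \<le> j" "j \<le> n" "SA T j = x + 1"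
        using SA_surj[of "x + 1"] x by auto
      show False using suf_SA_less_iff[of "i - 1" j] suf_SA_less_iff[of j i] i i1 j b
        by (auto simp: q_def)
    qed
  qed (use p q q1 in auto)
  then show ?thesis using Phi q1 by simp
qed

section \<open>Segments between consecutive run start values\<close>

abbreviation r :: nat where "r \<equiv> num_runs T"

text \<open>The entry of \<open>A\<^sup>d\<close> in the row of \<open>p\<close>, the first row
  excepted.\<close>

definition d :: "nat \<Rightarrow> int" where "d p = int p - int (Phi T p)"

lemma r_pos: "0 < r"
  using n_in_us length_us by (metis empty_iff empty_set length_greater_0_conv)

lemma us_mono: "i < j \<Longrightarrow> j < r \<Longrightarrow> us ! i < us ! j"
  using sorted_us length_us by (metis sorted_wrt_iff_nth_less)

lemma us_nth_range: "i < r \<Longrightarrow> 1 \<le> us ! i \<and> us ! i \<le> n"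
  using us_range[of "us ! i"] length_us by simp

lemma us_0: "us ! 0 = 1"
proof -
  obtain i where "i < r" "us ! i = 1" using one_in_us length_us by (metis in_set_conv_nth)
  then show ?thesis using us_mono[of 0 i] us_nth_range[of 0] r_pos by (cases i) auto
qed

lemma us_last: "us ! (r - 1) = n"
proof -
  obtain i where i: "i < r" "us ! i = n" using n_in_us length_us by (metis in_set_conv_nth)
  have "\<not> i < r - 1"
  proof
    assume "i < r - 1"
    then have "n < us ! (r - 1)" using us_mono[of i "r - 1"] i r_pos by simp
    then show False using us_nth_range[of "r - 1"] r_pos by simp
  qed
  then have "i = r - 1" using i by linarith
  then show ?thesis using i by simp
qed

lemma d_const:
  assumes "i + 1 < r" "us ! i \<le> p" "p < us ! (i + 1)"
  shows "d p = d (us ! i)"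
  using assms(2,3)
proof (induction p rule: dec_induct)
  case (step p)
  have "us ! (i + 1) \<le> n" using us_nth_range[of "i + 1"] assms(1) by simp
  moreover have "1 \<le> us ! i" using us_nth_range[of i] assms(1) by simp
  \<comment> \<open>Otherwise a run start value would lie strictly between two consecutive
    ones.\<close>
  moreover have "Suc p \<notin> set us"
  proof
    assume "Suc p \<in> set us"
    then obtain j where j: "j < r" "us ! j = Suc p" using length_us by (metis in_set_conv_nth)
    then have "i < j" using us_mono[of j i] step assms(1) by (cases i j rule: linorder_cases) auto
    moreover have "j < i + 1" using us_mono[of "i + 1" j] step j by (cases "i + 1" j rule: linorder_cases) auto
    ultimately show False by simp
  qed
  ultimately have "Phi T (p + 1) = Phi T p + 1" using step by (intro Phi_Suc) auto
  then show ?case using step by (simp add: d_def)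
qed simp

section \<open>Values of the differential suffix array and their multiplicities\<close>

lemma diff_suffix_array_eq:
  "diff_suffix_array T = int n # map (\<lambda>i. d (SA T i)) [2..<n + 1]"
proof -
  have "[1..<n + 1] = 1 # [2..<n + 1]"
    using n_pos upt_conv_Cons[of 1 "n + 1"] by (simp add: numeral_2_eq_2 del: upt_Suc)
  moreover have "map (\<lambda>i. if i = 1 then int (SA T 1) else int (SA T i) - int (SA T (i - 1))) [2..<n + 1]
      = map (\<lambda>i. d (SA T i)) [2..<n + 1]"
    using Phi_SA by (intro map_cong refl) (auto simp: d_def simp del: upt_Suc)
  ultimately show ?thesis using SA_1 by (simp add: diff_suffix_array_def del: upt_Suc)
qed

lemma SA_image: "bij_betw (SA T) {2..n} {1..<n}"
proof -
  have "bij_betw (SA T) ({1..n} - {1}) ({1..n} - {SA T 1})"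
    using SA_bij n_pos SA_range[of 1]
    by (intro bij_betw_DiffI bij_betw_singletonI) (auto simp: Suc_le_eq)
  moreover have "{1..n} - {1} = {2..n}" "{1..n} - {n} = {1..<n}" by auto
  ultimately show ?thesis unfolding SA_1 by simp
qed

lemma sum_us_segments:
  "m < r \<Longrightarrow> (\<Sum>p = 1..<us ! m. f p) = (\<Sum>i<m. \<Sum>p = us ! i..<us ! (i + 1). f p)"
  for f :: "nat \<Rightarrow> nat"
proof (induction m)
  case (Suc m)
  have "1 \<le> us ! m" "us ! m \<le> us ! (m + 1)"
    using us_nth_range[of m] us_mono[of m "m + 1"] Suc by auto
  then show ?case using Suc sum.atLeastLessThan_concat[of 1 "us ! m" "us ! (m + 1)" f] by simp
qed (simp add: us_0)

theorem count_diff_suffix_array: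
  "count_list (diff_suffix_array T) v =
     (if v = int n then 1 else 0) + (\<Sum>i<r - 1. if d (us ! i) = v then us ! (i + 1) - us ! i else 0)"
proof -
  have "count_list (map (\<lambda>i. d (SA T i)) [2..<n + 1]) v = card {i \<in> {2..n}. d (SA T i) = v}"
    by (subst count_list_eq_length_filter)
       (auto simp: filter_map comp_def distinct_length_filter intro!: arg_cong[where f = card])
  also have "\<dots> = (\<Sum>i = 2..n. if d (SA T i) = v then 1 else 0)"
    by (simp add: sum.If_cases Int_def)
  \<comment> \<open>Sum over text positions instead of rows: only there do equal differences form
    contiguous segments.\<close>
  also have "\<dots> = (\<Sum>p = 1..<n. if d p = v then 1 else 0)"
    by (rule sum.reindex_bij_betw[OF SA_image])
  also have "\<dots> = (\<Sum>i<r - 1. \<Sum>p = us ! i..<us ! (i + 1). if d p = v then 1 else 0)"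
    using sum_us_segments[of "r - 1"] us_last r_pos by simp
  also have "\<dots> = (\<Sum>i<r - 1. \<Sum>p = us ! i..<us ! (i + 1). if d (us ! i) = v then 1 else 0)"
  proof (intro sum.cong refl)
    fix i p assume "i \<in> {..<r - 1}" "p \<in> {us ! i..<us ! (i + 1)}"
    then have "d p = d (us ! i)" by (intro d_const) auto
    then show "(if d p = v then 1 else 0) = (if d (us ! i) = v then 1 else (0::nat))" by simp
  qed
  also have "\<dots> = (\<Sum>i<r - 1. if d (us ! i) = v then us ! (i + 1) - us ! i else 0)"
    by (intro sum.cong) auto
  finally show ?thesis by (simp add: diff_suffix_array_eq)
qed

theorem set_diff_suffix_array:
  "set (diff_suffix_array T) = insert (int n) ((\<lambda>i. d (us ! i)) ` {..<r - 1})"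
proof -
  have "v \<in> set (diff_suffix_array T) \<longleftrightarrow> v \<in> insert (int n) ((\<lambda>i. d (us ! i)) ` {..<r - 1})" for v
  proof -
    have "v \<in> set (diff_suffix_array T) \<longleftrightarrow> count_list (diff_suffix_array T) v \<noteq> 0"
      by (simp add: count_list_0_iff)
    \<comment> \<open>Every segment is nonempty because run start values increase strictly, so each
      of its values does occur.\<close>
    also have "\<dots> \<longleftrightarrow> v = int n \<or> (\<exists>i<r - 1. d (us ! i) = v)"
      using us_mono by (auto simp: count_diff_suffix_array not_le)
    finally show ?thesis by auto
  qed
  then show ?thesis by blast
qed

corollary card_diff_suffix_array: "card (set (diff_suffix_array T)) \<le> r + 1"
proof -
  have "card (set (diff_suffix_array T)) \<le> Suc (card ((\<lambda>i. d (us ! i)) ` {..<r - 1}))"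
    unfolding set_diff_suffix_array by (rule card_insert_le_m1) simp_all
  also have "\<dots> \<le> Suc (r - 1)" using card_image_le[of "{..<r - 1}"] by simp
  finally show ?thesis by simp
qed

end

section \<open>Symbolic execution of word RAM programs\<close>

declare alu.simps [simp del]

text \<open>The space condition covers only the first \<open>t\<close> steps, so that pieces of a
  computation can be concatenated.\<close>

definition exec :: "nat \<Rightarrow> instr list \<Rightarrow> nat \<Rightarrow> nat \<Rightarrow> config \<Rightarrow> config \<Rightarrow> bool" where
  "exec w P S t c c' \<longleftrightarrow> run w P c t = c' \<and>
     (\<forall>j<t. \<not> halted P (run w P c j) \<longrightarrow>
        accessed_by (P ! pc (run w P c j)) (run w P c j) \<subseteq> {..<S})"

lemma run_0: "run w P c 0 = c"
  by (simp add: run_def)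

lemma run_add: "run w P c (s + t) = run w P (run w P c s) t"
  by (simp add: run_def funpow_add add.commute[of s])

lemma run_Suc: "run w P c (Suc t) = run w P (step w P c) t"
  by (simp add: run_def funpow_Suc_right del: funpow.simps)

lemma exec_0 [simp]: "exec w P S 0 c c' \<longleftrightarrow> c = c'"
  by (auto simp: exec_def run_0)

lemma exec_Suc:
  "exec w P S (Suc t) c c' \<longleftrightarrow>
     (\<not> halted P c \<longrightarrow> accessed_by (P ! pc c) c \<subseteq> {..<S}) \<and> exec w P S t (step w P c) c'"
  unfolding exec_def by (auto simp: All_less_Suc2 run_0 run_Suc)

lemma exec_trans:
  "exec w P S s c c' \<Longrightarrow> exec w P S t c' c'' \<Longrightarrow> exec w P S (s + t) c c''"
  by (induction s arbitrary: c) (auto simp: exec_Suc)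

lemma run_halted: "halted P c \<Longrightarrow> run w P c t = c"
  by (induction t) (simp_all add: run_0 run_Suc step_def)

lemma halted_run_eq:
  assumes "halted P (run w P c s)" "halted P (run w P c t)"
  shows "run w P c s = run w P c t"
  using assms
proof (induction s t rule: linorder_wlog)
  case (le s t)
  then have "run w P c t = run w P (run w P c s) (t - s)" by (simp flip: run_add)
  then show ?case using run_halted le by simp
qed simp

text \<open>A halted configuration never changes, so one execution up to it settles space, result
  and running time of the whole computation.\<close>

lemma exec_halted:
  assumes "exec w P S t c c'" "halted P c'"
  shows "runs_in_space w P c S" "\<And>s. halted P (run w P c s) \<Longrightarrow> run w P c s = c'"
    "running_time w P c \<le> of_nat t"
proof -
  have t: "run w P c t = c'" using assms by (simp add: exec_def)
  then show "run w P c s = c'" if "halted P (run w P c s)" for s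
    using halted_run_eq that assms by metis
  have "s < t" if "\<not> halted P (run w P c s)" for s
  proof (rule ccontr)
    assume "\<not> s < t"
    then have "run w P c s = run w P c' (s - t)" using t run_add[of w P c t "s - t"] by simp
    then show False using run_halted assms that by simp
  qed
  then show "runs_in_space w P c S" using assms by (auto simp: runs_in_space_def exec_def)
  show "running_time w P c \<le> of_nat t"
    unfolding running_time_def using t assms by (intro INF_lower) simp
qed

text \<open>An explicit list of the registers in use lets the simplifier evaluate instructions; the
  value 0 beyond it agrees with the initial configuration.\<close>

definition st :: "nat \<Rightarrow> nat list \<Rightarrow> (nat \<Rightarrow> nat) \<Rightarrow> nat stream \<Rightarrow> config" where
  "st p xs M \<omega> = \<lparr>pc = p, regs = (\<lambda>a. if a < length xs then xs ! a else 0), mem = M, tape = \<omega>\<rparr>"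

lemma pc_st [simp]: "pc (st p xs M \<omega>) = p"
  by (simp add: st_def)

text \<open>The program counter after \<open>Suc 0\<close> would otherwise not be normalised to a numeral.\<close>

lemma st_2 [simp]: "st (Suc (Suc 0)) = st 2"
  by (simp add: numeral_2_eq_2)

text \<open>Trailing zeros of a register list are invisible, hence the condition on the
  lengths.\<close>

lemma st_eq_iff:
  assumes "length xs = length ys"
  shows "st p xs M \<omega> = st q ys N \<rho> \<longleftrightarrow> p = q \<and> xs = ys \<and> M = N \<and> \<omega> = \<rho>"
  using assms unfolding st_def by (auto intro!: nth_equalityI dest: fun_cong split: if_splits)

fun registers_of :: "instr \<Rightarrow> nat list" where
  "registers_of (Const a k) = [a]"
| "registers_of (Op f a b c) = [a, b, c]"
| "registers_of (Load a b) = [a, b]"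
| "registers_of (Store a b) = [a, b]"
| "registers_of (Rand a) = [a]"
| "registers_of (Jump l) = []"
| "registers_of (JumpEq a b l) = [a, b]"
| "registers_of (JumpLess a b l) = [a, b]"

fun next_st :: "nat \<Rightarrow> instr \<Rightarrow> nat \<Rightarrow> nat list \<Rightarrow> (nat \<Rightarrow> nat) \<Rightarrow> nat stream \<Rightarrow> config" where
  "next_st w (Const a k) p xs M \<omega> = st (p + 1) (xs[a := k mod 2 ^ w]) M \<omega>"
| "next_st w (Op f a b c) p xs M \<omega> = st (p + 1) (xs[a := alu w f (xs ! b) (xs ! c)]) M \<omega>"
| "next_st w (Load a b) p xs M \<omega> = st (p + 1) (xs[a := M (xs ! b)]) M \<omega>"
| "next_st w (Store a b) p xs M \<omega> = st (p + 1) xs (M(xs ! a := xs ! b)) \<omega>"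
| "next_st w (Rand a) p xs M \<omega> = st (p + 1) (xs[a := shd \<omega>]) M (stl \<omega>)"
| "next_st w (Jump l) p xs M \<omega> = st l xs M \<omega>"
| "next_st w (JumpEq a b l) p xs M \<omega> = st (if xs ! a = xs ! b then l else p + 1) xs M \<omega>"
| "next_st w (JumpLess a b l) p xs M \<omega> = st (if xs ! a < xs ! b then l else p + 1) xs M \<omega>"

fun access_st :: "instr \<Rightarrow> nat list \<Rightarrow> nat set" where
  "access_st (Load a b) xs = {xs ! b}"
| "access_st (Store a b) xs = {xs ! a}"
| "access_st _ xs = {}"

lemma exec_instr_st:
  "\<forall>a \<in> set (registers_of I). a < length xs \<Longrightarrow> exec_instr w I (st p xs M \<omega>) = next_st w I p xs M \<omega>"
  by (cases I) (auto simp: st_def fun_eq_iff nth_list_update)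

lemma accessed_by_st:
  "\<forall>a \<in> set (registers_of I). a < length xs \<Longrightarrow> accessed_by I (st p xs M \<omega>) = access_st I xs"
  by (cases I) (auto simp: st_def)

section \<open>A histogram program with a chained hash table\<close>

text \<open>
  Registers 0 to 7 hold the constants \<open>0\<close>, \<open>1\<close>, \<open>r\<close>, \<open>2r - 1\<close>, \<open>2r + 1\<close>, \<open>3r + 1\<close>, the odd multiplier
  and the divisor \<open>D\<close>; register 8 points to the current input pair, and register 9 counts the
  entries found so far. Entry \<open>k\<close> (counted from 1) is stored in its output position, the cells
  \<open>2k - 1\<close> and \<open>2k\<close>, which overwrites only input that has been consumed already. Cell \<open>2r + 1 + b\<close>
  holds the newest entry of bucket \<open>b\<close>, and cell \<open>3r + 1 + k\<close> the previous entry in the bucket of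
  entry \<open>k\<close>; the value 0 ends a chain. The loop over the input starts at 12, the search in a chain
  at 24, the update of an old entry at 32, the creation of a new one at 36, and the final entry
  \<open>(n, 1)\<close> is appended from 46 on.
\<close>

definition prog :: "instr list" where
  "prog =
    [Const 1 1,
     Load 2 0,
     Op Add 3 2 2,
     Op Add 4 3 1,
     Op Add 5 4 2,
     Op Sub 3 3 1,
     Op Sub 7 0 1,
     Op Div 7 7 2,
     Op Add 7 7 1,
     Rand 6,
     Op Or 6 6 1,
     Op Add 8 1 0,
     JumpEq 8 3 46,
     Load 10 8,
     Op Add 8 8 1,
     Load 11 8,
     Op Sub 11 10 11,
     Op Add 8 8 1,
     Load 12 8,
     Op Sub 12 12 10,
     Op Mul 13 6 11,
     Op Div 13 13 7,
     Op Add 13 13 4,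
     Load 14 13,
     JumpEq 14 0 36,
     Op Add 15 14 14,
     Op Sub 16 15 1,
     Load 16 16,
     JumpEq 16 11 32,
     Op Add 16 5 14,
     Load 14 16,
     Jump 24,
     Load 16 15,
     Op Add 16 16 12,
     Store 15 16,
     Jump 12,
     Op Add 9 9 1,
     Op Add 15 9 9,
     Store 15 12,
     Op Sub 16 15 1,
     Store 16 11,
     Load 16 13,
     Op Add 15 5 9,
     Store 15 16,
     Store 13 9,
     Jump 12,
     Op Add 9 9 1,
     Op Add 15 9 9,
     Load 16 3,
     Store 15 1,
     Op Sub 15 15 1,
     Store 15 16,
     Store 0 9]"

lemma length_prog: "length prog = 53"
  by (simp add: prog_def)

section \<open>Unfolding the program instruction by instruction\<close>

lemma registers_prog: "I \<in> set prog \<Longrightarrow> a \<in> set (registers_of I) \<Longrightarrow> a < 17"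
  by (auto simp: prog_def)

lemma prog_nth [simp]:
  "prog ! 0 = Const 1 1" "prog ! Suc 0 = Load 2 0" "prog ! 2 = Op Add 3 2 2" "prog ! 3 = Op Add 4 3 1"
  "prog ! 4 = Op Add 5 4 2" "prog ! 5 = Op Sub 3 3 1" "prog ! 6 = Op Sub 7 0 1"
  "prog ! 7 = Op Div 7 7 2" "prog ! 8 = Op Add 7 7 1" "prog ! 9 = Rand 6" "prog ! 10 = Op Or 6 6 1"
  "prog ! 11 = Op Add 8 1 0" "prog ! 12 = JumpEq 8 3 46" "prog ! 13 = Load 10 8"
  "prog ! 14 = Op Add 8 8 1" "prog ! 15 = Load 11 8" "prog ! 16 = Op Sub 11 10 11"
  "prog ! 17 = Op Add 8 8 1" "prog ! 18 = Load 12 8" "prog ! 19 = Op Sub 12 12 10"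
  "prog ! 20 = Op Mul 13 6 11" "prog ! 21 = Op Div 13 13 7" "prog ! 22 = Op Add 13 13 4"
  "prog ! 23 = Load 14 13" "prog ! 24 = JumpEq 14 0 36" "prog ! 25 = Op Add 15 14 14"
  "prog ! 26 = Op Sub 16 15 1" "prog ! 27 = Load 16 16" "prog ! 28 = JumpEq 16 11 32"
  "prog ! 29 = Op Add 16 5 14" "prog ! 30 = Load 14 16" "prog ! 31 = Jump 24"
  "prog ! 32 = Load 16 15" "prog ! 33 = Op Add 16 16 12" "prog ! 34 = Store 15 16"
  "prog ! 35 = Jump 12" "prog ! 36 = Op Add 9 9 1" "prog ! 37 = Op Add 15 9 9"
  "prog ! 38 = Store 15 12" "prog ! 39 = Op Sub 16 15 1" "prog ! 40 = Store 16 11"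
  "prog ! 41 = Load 16 13" "prog ! 42 = Op Add 15 5 9" "prog ! 43 = Store 15 16"
  "prog ! 44 = Store 13 9" "prog ! 45 = Jump 12" "prog ! 46 = Op Add 9 9 1"
  "prog ! 47 = Op Add 15 9 9" "prog ! 48 = Load 16 3" "prog ! 49 = Store 15 1"
  "prog ! 50 = Op Sub 15 15 1" "prog ! 51 = Store 15 16" "prog ! 52 = Store 0 9"
  by (simp_all add: prog_def)

lemma exec_prog_Suc:
  assumes "length xs = 17" "p < 53"
  shows "exec w prog S (Suc t) (st p xs M \<omega>) c' \<longleftrightarrow>
    access_st (prog ! p) xs \<subseteq> {..<S} \<and> exec w prog S t (next_st w (prog ! p) p xs M \<omega>) c'"
proof -
  have "\<forall>a \<in> set (registers_of (prog ! p)). a < length xs"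
    using registers_prog assms length_prog by (metis nth_mem)
  then show ?thesis
    using assms length_prog
    by (simp add: exec_Suc step_def halted_def exec_instr_st accessed_by_st)
qed

lemma exec_prog_numeral:
  assumes "length xs = 17" "p < 53"
  shows "exec w prog S (numeral t) (st p xs M \<omega>) c' \<longleftrightarrow>
    access_st (prog ! p) xs \<subseteq> {..<S} \<and> exec w prog S (pred_numeral t) (next_st w (prog ! p) p xs M \<omega>) c'"
  unfolding numeral_eq_Suc using assms by (rule exec_prog_Suc)

lemma alu_Add: "x + y < 2 ^ w \<Longrightarrow> alu w Add x y = x + y"
  by (simp add: alu.simps)

lemma alu_Sub: "y \<le> x \<Longrightarrow> x < 2 ^ w \<Longrightarrow> alu w Sub x y = x - y"
proof -
  assume a: "y \<le> x" "x < 2 ^ w"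
  then have "x + (2 ^ w - y) = (x - y) + 2 ^ w" by simp
  then show ?thesis using a by (simp only: alu.simps mod_add_self2) simp
qed

text \<open>Wraparound gives a program that is independent of \<open>w\<close> access to the largest
  word, from which it computes \<open>D\<close>.\<close>

lemma alu_Sub_0_1: "0 < w \<Longrightarrow> alu w Sub 0 (Suc 0) = 2 ^ w - 1"
  by (simp add: alu.simps)

lemmas exec_simps = exec_prog_numeral exec_prog_Suc st_eq_iff alu_Add alu_Sub

text \<open>Lists of entries have the newest entry first, so that the tail of a list is its earlier state.\<close>

fun head :: "(nat \<Rightarrow> nat) \<Rightarrow> (nat \<times> nat) list \<Rightarrow> nat \<Rightarrow> nat" where
  "head h [] b = 0"
| "head h ((k, c) # E) b = (if h k = b then Suc (length E) else head h E b)"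

text \<open>The entry in front of \<open>E\<close> has number \<open>length E + 1\<close>, which
  gives the addresses. Its link is the head of its bucket just before the insertion.\<close>

fun entries :: "nat \<Rightarrow> (nat \<Rightarrow> nat) \<Rightarrow> (nat \<Rightarrow> nat) \<Rightarrow> (nat \<times> nat) list \<Rightarrow> bool" where
  "entries r h M [] \<longleftrightarrow> True"
| "entries r h M ((k, c) # E) \<longleftrightarrow>
     M (2 * length E + 1) = k \<and> M (2 * length E + 2) = c \<and>
     M (3 * r + 2 + length E) = head h E (h k) \<and> entries r h M E"

section \<open>Chains in memory and the search in them\<close>

lemma entries_cong:
  assumes "entries r h M E"
    and "\<And>a. 1 \<le> a \<Longrightarrow> a \<le> 2 * length E \<Longrightarrow> M' a = M a"
    and "\<And>a. 3 * r + 2 \<le> a \<Longrightarrow> a < 3 * r + 2 + length E \<Longrightarrow> M' a = M a"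
  shows "entries r h M' E"
  using assms by (induction E) auto

lemma head_append_cong:
  "head h (E1 @ (k, c) # E2) b = head h (E1 @ (k, c') # E2) b"
  by (induction E1) auto

lemma entries_update:
  assumes "entries r h M (E1 @ (k, c) # E2)" "length (E1 @ (k, c) # E2) \<le> r"
  shows "entries r h (M(2 * length E2 + 2 := c')) (E1 @ (k, c') # E2)"
  using assms
proof (induction E1)
  case Nil
  then show ?case by (auto elim!: entries_cong)
next
  case (Cons e E1)
  then show ?case using head_append_cong[of h E1 k c E2 _ c'] by (cases e) auto
qed

lemma entries_nth:
  "entries r h M E \<Longrightarrow> j < length E \<Longrightarrow> (M (2 * j + 1), M (2 * j + 2)) = rev E ! j"
proof (induction E)
  case (Cons e E)
  then show ?case by (cases "j = length E"; cases e) (auto simp: nth_append)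
qed simp

text \<open>A failed comparison takes 8 instructions and moves to the head of the same bucket in an
  older list, hence the induction on \<open>E\<close>; entries of other buckets cost nothing. The
  extra 1 is the test for the end of the chain.\<close>

lemma chain_search_absent:
  assumes "entries r h M E" "length E < r" "16 * r < 2 ^ w" "x \<notin> fst ` set E"
  shows "\<exists>q' s' t. t \<le> 8 * length (filter (\<lambda>e. h (fst e) = b) E) + 1 \<and>
    exec w prog (6 * r) t
      (st 24 [0, 1, r, z3, z4, 3 * r + 1, a, D, i, m, u, x, c, hb, head h E b, q, s] M \<omega>)
      (st 36 [0, 1, r, z3, z4, 3 * r + 1, a, D, i, m, u, x, c, hb, 0, q', s'] M \<omega>)"
  using assms
proof (induction E arbitrary: q s)
  case Nil
  then show ?case by (intro exI[of _ q] exI[of _ s] exI[of _ "Suc 0"]) (simp add: exec_simps)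
next
  case (Cons e E)
  obtain k cc where e: "e = (k, cc)" by force
  show ?case
  proof (cases "h k = b")
    case False
    then show ?thesis using Cons e by simp
  next
    case True
    let ?q = "Suc (length E) + Suc (length E)" and ?s = "3 * r + 2 + length E"
    obtain q' s' t where t: "t \<le> 8 * length (filter (\<lambda>e. h (fst e) = b) E) + 1"
      "exec w prog (6 * r) t
        (st 24 [0, 1, r, z3, z4, 3 * r + 1, a, D, i, m, u, x, c, hb, head h E b, ?q, ?s] M \<omega>)
        (st 36 [0, 1, r, z3, z4, 3 * r + 1, a, D, i, m, u, x, c, hb, 0, q', s'] M \<omega>)"
      using Cons.IH[of ?q ?s] Cons.prems e by auto
    have M: "M (Suc (2 * length E)) = k" "M (Suc (Suc (3 * r + length E))) = head h E b"
      using Cons.prems True e by simp_all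
    have "exec w prog (6 * r) 8
        (st 24 [0, 1, r, z3, z4, 3 * r + 1, a, D, i, m, u, x, c, hb, head h (e # E) b, q, s] M \<omega>)
        (st 24 [0, 1, r, z3, z4, 3 * r + 1, a, D, i, m, u, x, c, hb, head h E b, ?q, ?s] M \<omega>)"
      using Cons.prems True e M by (simp add: exec_simps mult_2[symmetric])
    from exec_trans[OF this t(2)] show ?thesis using t(1) True e
      by (intro exI[of _ q'] exI[of _ s'] exI[of _ "8 + t"]) simp
  qed
qed

text \<open>The entries in \<open>E1\<close> are newer and are met first, at 8 instructions for each
  in bucket \<open>b\<close>. The match is left after 5 instructions, within its own share of
  8.\<close>

lemma chain_search_present:
  assumes "entries r h M (E1 @ (x, cc) # E2)" "length (E1 @ (x, cc) # E2) < r" "16 * r < 2 ^ w"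
    "x \<notin> fst ` set E1" "h x = b"
  shows "\<exists>t \<le> 8 * length (filter (\<lambda>e. h (fst e) = b) (E1 @ (x, cc) # E2)).
    exec w prog (6 * r) t
      (st 24 [0, 1, r, z3, z4, 3 * r + 1, a, D, i, m, u, x, c, hb, head h (E1 @ (x, cc) # E2) b, q, s] M \<omega>)
      (st 32 [0, 1, r, z3, z4, 3 * r + 1, a, D, i, m, u, x, c, hb, Suc (length E2), 2 * length E2 + 2, x] M \<omega>)"
  using assms
proof (induction E1 arbitrary: q s)
  case Nil
  then show ?case by (intro exI[of _ 5]) (simp add: exec_simps mult_2[symmetric])
next
  case (Cons e E1)
  obtain k cc' where e: "e = (k, cc')" by force
  let ?E = "E1 @ (x, cc) # E2"
  show ?case
  proof (cases "h k = b")
    case False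
    then show ?thesis using Cons e by simp
  next
    case True
    let ?q = "Suc (length ?E) + Suc (length ?E)" and ?s = "3 * r + 2 + length ?E"
    obtain t where t: "t \<le> 8 * length (filter (\<lambda>e. h (fst e) = b) ?E)"
      "exec w prog (6 * r) t
        (st 24 [0, 1, r, z3, z4, 3 * r + 1, a, D, i, m, u, x, c, hb, head h ?E b, ?q, ?s] M \<omega>)
        (st 32 [0, 1, r, z3, z4, 3 * r + 1, a, D, i, m, u, x, c, hb, Suc (length E2), 2 * length E2 + 2, x] M \<omega>)"
      using Cons.IH[of ?q ?s] Cons.prems e by auto
    define l where "l = length ?E"
    have M: "M (Suc (2 * l)) = k" "M (Suc (Suc (3 * r + l))) = head h ?E b" "l < r" "k \<noteq> x"
      and hd: "head h ((e # E1) @ (x, cc) # E2) b = Suc l"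
      using Cons.prems True e by (simp_all add: l_def)
    have "exec w prog (6 * r) 8
        (st 24 [0, 1, r, z3, z4, 3 * r + 1, a, D, i, m, u, x, c, hb, head h ((e # E1) @ (x, cc) # E2) b, q, s] M \<omega>)
        (st 24 [0, 1, r, z3, z4, 3 * r + 1, a, D, i, m, u, x, c, hb, head h ?E b, ?q, ?s] M \<omega>)"
      unfolding hd l_def[symmetric] using Cons.prems(3) M by (simp add: exec_simps mult_2[symmetric])
    from exec_trans[OF this t(2)] show ?thesis using t(1) True e
      by (intro exI[of _ "8 + t"]) simp
  qed
qed

text \<open>Collects what the program relies on, independently of texts. The factor 32 keeps
  addresses and sums below \<open>2 ^ w\<close> and leaves room for the sign of differences between
  \<open>- N\<close> and \<open>N\<close>.\<close>

locale histogram_input =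
  fixes ps :: "(nat \<times> nat) list" and N w :: nat
  assumes nonempty: "ps \<noteq> []"
    and sorted_fst: "sorted_wrt (<) (map fst ps)"
    and fst_last: "fst (last ps) = N"
    and range: "\<And>u v. (u, v) \<in> set ps \<Longrightarrow> 1 \<le> u \<and> u \<le> N \<and> 1 \<le> v \<and> v \<le> N"
    and width: "32 * N \<le> 2 ^ w"
begin

definition r :: nat where "r = length ps"
definition U :: "nat \<Rightarrow> nat" where "U j = fst (ps ! j)"
definition V :: "nat \<Rightarrow> nat" where "V j = snd (ps ! j)"
text \<open>The key is the difference in two's complement, so negative values are hashed like any
  other word.\<close>

definition K :: "nat \<Rightarrow> nat" where "K j = alu w Sub (U j) (V j)"
definition C :: "nat \<Rightarrow> nat" where "C j = U (Suc j) - U j"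
text \<open>For \<open>r = 1\<close> the addition overflows to \<open>D = 0\<close>, but then no key is hashed.\<close>

definition D :: nat where "D = alu w Add ((2 ^ w - 1) div r) 1"

section \<open>Size bounds that exclude overflow\<close>

lemma r_pos: "0 < r"
  using nonempty by (simp add: r_def)

lemma UV_range: "j < r \<Longrightarrow> 1 \<le> U j \<and> U j \<le> N \<and> 1 \<le> V j \<and> V j \<le> N"
  using range[of "U j" "V j"] by (simp add: U_def V_def r_def)

lemma U_mono: "i < j \<Longrightarrow> j < r \<Longrightarrow> U i < U j"
  using sorted_fst by (simp add: sorted_wrt_iff_nth_less U_def r_def)

lemma U_last: "U (r - 1) = N"
  using fst_last nonempty by (simp add: U_def r_def last_conv_nth)

lemma r_le_N: "r \<le> N"
proof -
  have "distinct (map fst ps)" using sorted_fst by (simp add: strict_sorted_iff)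
  then have "r = card (fst ` set ps)" by (metis distinct_card length_map list.set_map r_def)
  also have "\<dots> \<le> card {1..N}" using range by (intro card_mono) force+
  finally show ?thesis by simp
qed

lemma r_width: "16 * r < 2 ^ w" and w_pos: "0 < w"
proof -
  show "16 * r < 2 ^ w" using r_le_N r_pos width by linarith
  then show "0 < w" using r_pos by (cases w) auto
qed

lemma sum_C: "i < r \<Longrightarrow> (\<Sum>j<i. C j) = U i - U 0"
proof (induction i)
  case (Suc i)
  then show ?case using U_mono[of i "Suc i"] U_mono[of 0 i] by (cases "i = 0") (auto simp: C_def)
qed simp

text \<open>The weights telescope, so even their total is at most \<open>N\<close> and no counter
  overflows.\<close>

lemma sum_C_le: "i < r \<Longrightarrow> (\<Sum>j<i. if K j = k then C j else 0) \<le> N"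
proof -
  assume i: "i < r"
  have "(\<Sum>j<i. if K j = k then C j else 0) \<le> (\<Sum>j<i. C j)" by (intro sum_mono) simp
  also have "\<dots> \<le> N" using sum_C[OF i] UV_range[OF i] by linarith
  finally show ?thesis .
qed

text \<open>Because of \<open>length E \<le> i\<close>, the cells of the entries overlap consumed
  input only. The last conjuncts say that the table is the histogram of the first \<open>i\<close>
  pairs.\<close>

definition loop_inv :: "(nat \<Rightarrow> nat) \<Rightarrow> nat \<Rightarrow> (nat \<times> nat) list \<Rightarrow> (nat \<Rightarrow> nat) \<Rightarrow> bool" where
  "loop_inv h i E M \<longleftrightarrow> entries r h M E \<and> length E \<le> i
     \<and> (\<forall>j. i \<le> j \<longrightarrow> j < r \<longrightarrow> M (2 * j + 1) = U j \<and> M (2 * j + 2) = V j)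
     \<and> (\<forall>b<r. M (2 * r + 1 + b) = head h E b)
     \<and> distinct (map fst E) \<and> fst ` set E = K ` {..<i}
     \<and> (\<forall>e \<in> set E. snd e = (\<Sum>j<i. if K j = fst e then C j else 0))"

lemma loop_inv_input:
  "loop_inv h i E M \<Longrightarrow> i \<le> j \<Longrightarrow> j < r \<Longrightarrow> M (2 * j + 1) = U j \<and> M (2 * j + 2) = V j"
  unfolding loop_inv_def by blast

lemma loop_inv_head: "loop_inv h i E M \<Longrightarrow> b < r \<Longrightarrow> M (2 * r + 1 + b) = head h E b"
  unfolding loop_inv_def by blast

text \<open>Registers 10 to 16 are scratch space whose contents do not survive an iteration, so they
  are left open.\<close>

definition at_loop :: "nat \<Rightarrow> nat \<Rightarrow> nat \<Rightarrow> (nat \<Rightarrow> nat) \<Rightarrow> nat stream \<Rightarrow> config \<Rightarrow> bool" where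
  "at_loop a i m M \<omega> c \<longleftrightarrow> (\<exists>z10 z11 z12 z13 z14 z15 z16.
     c = st 12 [0, 1, r, 2 * r - 1, 2 * r + 1, 3 * r + 1, a, D, 2 * i + 1, m,
                z10, z11, z12, z13, z14, z15, z16] M \<omega>)"

section \<open>Initialisation, final entry and one pass through the loop\<close>

lemma exec_init:
  assumes "M 0 = r"
  shows "\<exists>c. exec w prog (6 * r) 12 (st 0 [0,0,0,0,0,0,0,0,0,0,0,0,0,0,0,0,0] M \<omega>) c \<and>
    at_loop (shd \<omega> OR 1) 0 0 M (stl \<omega>) c"
  unfolding at_loop_def
  by (rule exI, rule conjI[rotated], (rule exI)+, rule refl)
    (use r_pos w_pos r_width assms in \<open>simp add: exec_simps alu_Sub_0_1 alu.simps(4,7) D_def mult_2[symmetric]\<close>)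

text \<open>The last pair is never hashed; its first component is \<open>N\<close>. It is loaded
  before the appended entry is stored, which may occupy the same cell.\<close>

lemma exec_final:
  assumes c: "at_loop a (r - 1) (length E) M \<omega> c" and inv: "loop_inv h (r - 1) E M"
  shows "\<exists>xs. exec w prog (6 * r) 8 c
    (st 53 xs (M(2 * length E + 2 := 1, 2 * length E + 1 := N, 0 := length E + 1)) \<omega>)"
proof -
  have E: "length E < r" using inv r_pos by (auto simp: loop_inv_def)
  have "M (2 * (r - 1) + 1) = U (r - 1)" using inv r_pos by (auto simp: loop_inv_def)
  moreover have "2 * (r - 1) + 1 = 2 * r - 1" using r_pos by linarith
  ultimately have M: "M (2 * r - Suc 0) = N" and r: "2 * (r - Suc 0) + 1 = 2 * r - Suc 0" using U_last by simp_all
  obtain z10 z11 z12 z13 z14 z15 z16 where c: "c = st 12 [0, 1, r, 2 * r - 1, 2 * r + 1, 3 * r + 1, a, D,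
      2 * (r - 1) + 1, length E, z10, z11, z12, z13, z14, z15, z16] M \<omega>"
    using c unfolding at_loop_def by blast
  show ?thesis
    unfolding c
    by (rule exI[of _ "[0, 1, r, 2 * r - 1, 2 * r + 1, 3 * r + 1, a, D, 2 * r - 1, length E + 1,
          z10, z11, z12, z13, z14, 2 * length E + 1, N]"])
      (use E M r r_pos r_width in \<open>simp add: exec_simps mult_2[symmetric]\<close>)
qed

lemma loop_step_start:
  assumes "loop_inv h i E M" "i + 1 < r" "\<And>x. alu w Div (alu w Mul a x) D = h x" "\<And>x. h x < r"
    "at_loop a i m M \<omega> c"
  shows "\<exists>z15 z16. exec w prog (6 * r) 12 c
    (st 24 [0, 1, r, 2 * r - 1, 2 * r + 1, 3 * r + 1, a, D, 2 * (i + 1) + 1, m,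
            U i, K i, C i, 2 * r + 1 + h (K i), head h E (h (K i)), z15, z16] M \<omega>)"
proof -
  obtain z10 z11 z12 z13 z14 z15 z16 where c: "c = st 12 [0, 1, r, 2 * r - 1, 2 * r + 1, 3 * r + 1, a, D,
      2 * i + 1, m, z10, z11, z12, z13, z14, z15, z16] M \<omega>"
    using assms(5) unfolding at_loop_def by blast
  have M: "M (Suc (2 * i)) = U i" "M (Suc (Suc (2 * i))) = V i"
      "M (Suc (Suc (Suc (2 * i)))) = U (Suc i)"
      "M (Suc (h (K i) + 2 * r)) = head h E (h (K i))"
    using loop_inv_input[OF assms(1), of i] loop_inv_input[OF assms(1), of "Suc i"] loop_inv_head[OF assms(1,4)] assms(2)
    by (auto simp: add.commute)
  have U: "U i < U (Suc i)" "U (Suc i) \<le> N" using U_mono[of i "Suc i"] UV_range[of "Suc i"] assms(2) by auto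
  have K: "alu w Sub (U i) (V i) = K i" by (simp add: K_def)
  have C: "alu w Sub (U (Suc i)) (U i) = C i" using U width by (simp add: alu_Sub C_def)
  \<comment> \<open>The exit test fails: the pointer has not reached the last pair.\<close>
  have ne: "Suc (2 * i) \<noteq> 2 * r - Suc 0" using assms(2) by linarith
  note h = assms(3) assms(4)[of "K i"]
  have "alu w Add (h (K i)) (Suc (2 * r)) = Suc (h (K i) + 2 * r)" using h(2) r_width by (simp add: alu_Add)
  then show ?thesis unfolding c
    by (intro exI[of _ z15] exI[of _ z16])
      (use M K C ne h assms(2) r_width in \<open>simp add: exec_prog_numeral exec_prog_Suc st_eq_iff alu_Add\<close>)
qed

text \<open>Only the count cell of the matching entry changes. Keys stay as they are, and with them
  all chains.\<close>

lemma loop_step_present: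
  assumes inv: "loop_inv h i (E1 @ (K i, cc) # E2) M" and i: "i + 1 < r"
  shows "loop_inv h (Suc i) (E1 @ (K i, cc + C i) # E2) (M(2 * length E2 + 2 := cc + C i))"
    and "\<exists>c'. exec w prog (6 * r) 4
      (st 32 [0, 1, r, 2 * r - 1, 2 * r + 1, 3 * r + 1, a, D, 2 * (i + 1) + 1, m,
        u, x, C i, hb, p, 2 * length E2 + 2, z] M \<omega>) c' \<and>
      at_loop a (Suc i) m (M(2 * length E2 + 2 := cc + C i)) \<omega> c'"
proof -
  let ?E = "E1 @ (K i, cc) # E2" and ?E' = "E1 @ (K i, cc + C i) # E2"
  let ?M' = "M(2 * length E2 + 2 := cc + C i)"
  have entries: "entries r h M ?E" and len: "length ?E \<le> i" and dist: "distinct (map fst ?E)"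
    and keys: "fst ` set ?E = K ` {..<i}"
    and vals: "\<And>e. e \<in> set ?E \<Longrightarrow> snd e = (\<Sum>j<i. if K j = fst e then C j else 0)"
    using inv unfolding loop_inv_def by blast+
  have cc: "cc = (\<Sum>j<i. if K j = K i then C j else 0)" using vals[of "(K i, cc)"] by simp
  show "loop_inv h (Suc i) ?E' ?M'"
    unfolding loop_inv_def
  proof (intro conjI)
    show "entries r h ?M' ?E'" using entries len i by (intro entries_update) auto
    show "length ?E' \<le> Suc i" using len by simp
    show "\<forall>j. Suc i \<le> j \<longrightarrow> j < r \<longrightarrow> ?M' (2 * j + 1) = U j \<and> ?M' (2 * j + 2) = V j"
      using loop_inv_input[OF inv] len by auto
    show "\<forall>b<r. ?M' (2 * r + 1 + b) = head h ?E' b"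
      using loop_inv_head[OF inv] len i head_append_cong[of h E1 "K i" cc E2 _ "cc + C i"] by auto
    show "distinct (map fst ?E')" using dist by simp
    have "fst ` set ?E' = insert (K i) (fst ` set ?E)" by auto
    then show "fst ` set ?E' = K ` {..<Suc i}" unfolding keys by (auto simp: lessThan_Suc)
    show "\<forall>e \<in> set ?E'. snd e = (\<Sum>j<Suc i. if K j = fst e then C j else 0)"
    proof
      fix e assume e: "e \<in> set ?E'"
      show "snd e = (\<Sum>j<Suc i. if K j = fst e then C j else 0)"
      proof (cases "e = (K i, cc + C i)")
        case True
        then show ?thesis using cc by simp
      next
        case False
        then have "e \<in> set E1 \<union> set E2" using e by auto
        then have "e \<in> set ?E" "fst e \<noteq> K i" using dist by (auto simp: rev_image_eqI)
        then show ?thesis using vals[of e] by simp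
      qed
    qed
  qed
  \<comment> \<open>The new count is again a partial sum of weights, so the addition does not wrap
    around.\<close>
  have "cc + C i = (\<Sum>j<Suc i. if K j = K i then C j else 0)" using cc by simp
  also have "\<dots> \<le> N" using sum_C_le[of "Suc i" "K i"] i by simp
  finally have bound: "cc + C i < 2 ^ w" using width r_pos r_le_N by linarith
  have "(M(2 * length E2 + 2)) = cc" using entries by (induction E1) auto
  then show "\<exists>c'. exec w prog (6 * r) 4
      (st 32 [0, 1, r, 2 * r - 1, 2 * r + 1, 3 * r + 1, a, D, 2 * (i + 1) + 1, m,
        u, x, C i, hb, p, 2 * length E2 + 2, z] M \<omega>) c' \<and> at_loop a (Suc i) m ?M' \<omega> c'"
    using bound len i unfolding at_loop_def
    by (intro exI[of _ "st 12 [0, 1, r, 2 * r - 1, 2 * r + 1, 3 * r + 1, a, D, 2 * (i + 1) + 1, m,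
        u, x, C i, hb, p, 2 * length E2 + 2, cc + C i] ?M' \<omega>"] conjI)
       (simp add: exec_simps, force)
qed

text \<open>Entries, bucket heads and links lie in disjoint ranges of cells, so the four writes
  leave the older entries intact.\<close>

lemma loop_step_absent:
  assumes inv: "loop_inv h i E M" and i: "i + 1 < r" and absent: "K i \<notin> fst ` set E" and h: "\<And>x. h x < r"
  defines "M' \<equiv> M(2 * length E + 2 := C i, 2 * length E + 1 := K i,
     3 * r + 2 + length E := head h E (h (K i)), 2 * r + 1 + h (K i) := length E + 1)"
  shows "loop_inv h (Suc i) ((K i, C i) # E) M'"
    and "\<exists>c'. exec w prog (6 * r) 10
      (st 36 [0, 1, r, 2 * r - 1, 2 * r + 1, 3 * r + 1, a, D, 2 * (i + 1) + 1, length E,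
        u, K i, C i, 2 * r + 1 + h (K i), p, q, z] M \<omega>) c' \<and>
      at_loop a (Suc i) (length E + 1) M' \<omega> c'"
proof -
  let ?E' = "(K i, C i) # E"
  have entries: "entries r h M E" and len: "length E \<le> i" and dist: "distinct (map fst E)"
    and keys: "fst ` set E = K ` {..<i}"
    and vals: "\<And>e. e \<in> set E \<Longrightarrow> snd e = (\<Sum>j<i. if K j = fst e then C j else 0)"
    using inv unfolding loop_inv_def by blast+
  note hr = h[of "K i"]
  show "loop_inv h (Suc i) ?E' M'"
    unfolding loop_inv_def
  proof (intro conjI)
    have "entries r h M' E" using entries by (rule entries_cong) (use len i hr in \<open>auto simp: M'_def\<close>)
    then show "entries r h M' ?E'" using len i hr by (simp add: M'_def)
    show "length ?E' \<le> Suc i" using len by simp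
    show "\<forall>j. Suc i \<le> j \<longrightarrow> j < r \<longrightarrow> M' (2 * j + 1) = U j \<and> M' (2 * j + 2) = V j"
      using loop_inv_input[OF inv] len by (auto simp: M'_def)
    show "\<forall>b<r. M' (2 * r + 1 + b) = head h ?E' b"
      using loop_inv_head[OF inv] len i by (auto simp: M'_def)
    show "distinct (map fst ?E')" using dist absent by simp
    show "fst ` set ?E' = K ` {..<Suc i}" using keys by (simp add: lessThan_Suc)
    show "\<forall>e \<in> set ?E'. snd e = (\<Sum>j<Suc i. if K j = fst e then C j else 0)"
    proof
      fix e assume e: "e \<in> set ?E'"
      show "snd e = (\<Sum>j<Suc i. if K j = fst e then C j else 0)"
      proof (cases "e \<in> set E")
        case True
        then have "fst e \<noteq> K i" using absent by (auto simp: rev_image_eqI)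
        then show ?thesis using vals[OF True] by simp
      next
        case False
        \<comment> \<open>A key missing from the table has not occurred among the first
          \<open>i\<close> pairs, so its earlier weight is 0.\<close>
        have "K j \<noteq> K i" if "j < i" for j using that absent keys by (metis imageI lessThan_iff)
        then have "(\<Sum>j<i. if K j = K i then C j else 0) = 0" by simp
        then show ?thesis using False e by simp
      qed
    qed
  qed
  define hb where "hb = 2 * r + 1 + h (K i)"
  have hb: "2 * r < hb" "hb < 3 * r + 1" using hr by (auto simp: hb_def)
  have "M hb = head h E (h (K i))" using loop_inv_head[OF inv hr] by (simp add: hb_def)
  then show "\<exists>c'. exec w prog (6 * r) 10
      (st 36 [0, 1, r, 2 * r - 1, 2 * r + 1, 3 * r + 1, a, D, 2 * (i + 1) + 1, length E,
        u, K i, C i, 2 * r + 1 + h (K i), p, q, z] M \<omega>) c' \<and>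
      at_loop a (Suc i) (length E + 1) M' \<omega> c'"
    using hb len i r_width unfolding at_loop_def hb_def[symmetric] M'_def
    by (intro exI[of _ "st 12 [0, 1, r, 2 * r - 1, 2 * r + 1, 3 * r + 1, a, D, 2 * (i + 1) + 1,
        length E + 1, u, K i, C i, hb, p, 3 * r + 2 + length E, head h E (h (K i))]
          (M(2 * length E + 2 := C i, 2 * length E + 1 := K i,
             3 * r + 2 + length E := head h E (h (K i)), hb := length E + 1)) \<omega>"] conjI)
       (simp add: exec_simps mult_2[symmetric], force)
qed

text \<open>The 23 consists of 12 instructions before the search, 1 for the end of the chain and 10
  for a new entry; updating an old entry takes only 4.\<close>

lemma loop_step:
  assumes inv: "loop_inv h i E M" and i: "i + 1 < r" and c: "at_loop a i (length E) M \<omega> c"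
    and h: "\<And>x. alu w Div (alu w Mul a x) D = h x" "\<And>x. h x < r"
  shows "\<exists>t E' M' c'. t \<le> 23 + 8 * length (filter (\<lambda>e. h (fst e) = h (K i)) E) \<and>
    loop_inv h (Suc i) E' M' \<and> at_loop a (Suc i) (length E') M' \<omega> c' \<and>
    exec w prog (6 * r) t c c'"
proof -
  obtain z15 z16 where start: "exec w prog (6 * r) 12 c
    (st 24 [0, 1, r, 2 * r - 1, 2 * r + 1, 3 * r + 1, a, D, 2 * (i + 1) + 1, length E,
            U i, K i, C i, 2 * r + 1 + h (K i), head h E (h (K i)), z15, z16] M \<omega>)"
    using loop_step_start[OF inv i h c] by blast
  have entries: "entries r h M E" and "length E \<le> i" and dist: "distinct (map fst E)"
    using inv unfolding loop_inv_def by blast+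
  then have len: "length E < r" using i by simp
  show ?thesis
  proof (cases "K i \<in> fst ` set E")
    case False
    obtain q s t where t: "t \<le> 8 * length (filter (\<lambda>e. h (fst e) = h (K i)) E) + 1"
      "exec w prog (6 * r) t
        (st 24 [0, 1, r, 2 * r - 1, 2 * r + 1, 3 * r + 1, a, D, 2 * (i + 1) + 1, length E,
          U i, K i, C i, 2 * r + 1 + h (K i), head h E (h (K i)), z15, z16] M \<omega>)
        (st 36 [0, 1, r, 2 * r - 1, 2 * r + 1, 3 * r + 1, a, D, 2 * (i + 1) + 1, length E,
          U i, K i, C i, 2 * r + 1 + h (K i), 0, q, s] M \<omega>)"
      using chain_search_absent[OF entries len r_width False] by blast
    note step = loop_step_absent[OF inv i False h(2)]
    obtain M' c' where M': "loop_inv h (Suc i) ((K i, C i) # E) M'"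
        "at_loop a (Suc i) (length E + 1) M' \<omega> c'" and
      e: "exec w prog (6 * r) 10
        (st 36 [0, 1, r, 2 * r - 1, 2 * r + 1, 3 * r + 1, a, D, 2 * (i + 1) + 1, length E,
          U i, K i, C i, 2 * r + 1 + h (K i), 0, q, s] M \<omega>) c'"
      using step by blast
    have "exec w prog (6 * r) (12 + (t + 10)) c c'"
      using exec_trans[OF start exec_trans[OF t(2) e]] .
    moreover have "12 + (t + 10) \<le> 23 + 8 * length (filter (\<lambda>e. h (fst e) = h (K i)) E)"
      using t(1) by linarith
    moreover have "at_loop a (Suc i) (length ((K i, C i) # E)) M' \<omega> c'" using M'(2) by simp
    ultimately show ?thesis using M'(1) by blast
  next
    case True
    then obtain cc where "(K i, cc) \<in> set E" by force
    then obtain E1 E2 where E: "E = E1 @ (K i, cc) # E2" by (meson split_list)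
    have nin: "K i \<notin> fst ` set E1" using dist E by auto
    obtain t where t: "t \<le> 8 * length (filter (\<lambda>e. h (fst e) = h (K i)) E)"
      "exec w prog (6 * r) t
        (st 24 [0, 1, r, 2 * r - 1, 2 * r + 1, 3 * r + 1, a, D, 2 * (i + 1) + 1, length E,
          U i, K i, C i, 2 * r + 1 + h (K i), head h E (h (K i)), z15, z16] M \<omega>)
        (st 32 [0, 1, r, 2 * r - 1, 2 * r + 1, 3 * r + 1, a, D, 2 * (i + 1) + 1, length E,
          U i, K i, C i, 2 * r + 1 + h (K i), Suc (length E2), 2 * length E2 + 2, K i] M \<omega>)"
      using chain_search_present[OF entries[unfolded E] len[unfolded E] r_width nin refl] unfolding E
      by blast
    obtain M' c' where M': "loop_inv h (Suc i) (E1 @ (K i, cc + C i) # E2) M'"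
        "at_loop a (Suc i) (length E) M' \<omega> c'" and
      e: "exec w prog (6 * r) 4
        (st 32 [0, 1, r, 2 * r - 1, 2 * r + 1, 3 * r + 1, a, D, 2 * (i + 1) + 1, length E,
          U i, K i, C i, 2 * r + 1 + h (K i), Suc (length E2), 2 * length E2 + 2, K i] M \<omega>) c'"
      using loop_step_present[OF inv[unfolded E] i] by blast
    have "exec w prog (6 * r) (12 + (t + 4)) c c'"
      using exec_trans[OF start exec_trans[OF t(2) e]] .
    moreover have "12 + (t + 4) \<le> 23 + 8 * length (filter (\<lambda>e. h (fst e) = h (K i)) E)"
      using t(1) by linarith
    moreover have "at_loop a (Suc i) (length (E1 @ (K i, cc + C i) # E2)) M' \<omega> c'"
      using M'(2) E by simp
    ultimately show ?thesis using M'(1) by blast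
  qed
qed

text \<open>Counting over all keys that are ever hashed, instead of those already in the table,
  makes the bound independent of the state of the loop.\<close>

definition collisions :: "(nat \<Rightarrow> nat) \<Rightarrow> nat \<Rightarrow> nat" where
  "collisions h i = card {k \<in> K ` {..<r - 1}. h k = h (K i)}"

lemma loop_iterate:
  assumes "loop_inv h 0 [] M" "at_loop a 0 0 M \<omega> c" "i < r"
    and h: "\<And>x. alu w Div (alu w Mul a x) D = h x" "1 < r \<Longrightarrow> \<forall>x. h x < r"
  shows "\<exists>t E' M' c'. t \<le> (\<Sum>j<i. 23 + 8 * collisions h j) \<and>
    loop_inv h i E' M' \<and> at_loop a i (length E') M' \<omega> c' \<and> exec w prog (6 * r) t c c'"
  using assms(3)
proof (induction i)
  case 0
  have "at_loop a 0 (length []) M \<omega> c" using assms(2) by simp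
  then show ?case using assms(1) exec_0 by fastforce
next
  case (Suc i)
  obtain t E' M' c' where IH: "t \<le> (\<Sum>j<i. 23 + 8 * collisions h j)" "loop_inv h i E' M'"
    "at_loop a i (length E') M' \<omega> c'" "exec w prog (6 * r) t c c'"
    using Suc by auto
  \<comment> \<open>A further iteration implies \<open>1 < r\<close>, which is what bounds the hash
    values by \<open>r\<close>.\<close>
  obtain s E'' M'' c'' where s: "s \<le> 23 + 8 * length (filter (\<lambda>e. h (fst e) = h (K i)) E')"
    "loop_inv h (Suc i) E'' M''" "at_loop a (Suc i) (length E'') M'' \<omega> c''"
    "exec w prog (6 * r) s c' c''"
    using loop_step[OF IH(2) _ IH(3) h(1)] h(2) Suc.prems by auto
  have keys: "distinct (map fst E')" "fst ` set E' = K ` {..<i}" using IH(2) by (auto simp: loop_inv_def)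
  have "length (filter (\<lambda>e. h (fst e) = h (K i)) E') = length (filter (\<lambda>k. h k = h (K i)) (map fst E'))"
    by (simp add: filter_map comp_def)
  also have "\<dots> = card {k \<in> fst ` set E'. h k = h (K i)}"
    using keys(1) by (subst distinct_length_filter) (auto intro!: arg_cong[where f = card])
  also have "\<dots> \<le> collisions h i"
    unfolding collisions_def keys(2) using Suc.prems by (intro card_mono) auto
  finally have "t + s \<le> (\<Sum>j<Suc i. 23 + 8 * collisions h j)" using IH(1) s(1) by simp
  then show ?case using s exec_trans[OF IH(4) s(4)] by blast
qed

section \<open>Decoding the output\<close>

definition dif :: "nat \<Rightarrow> int" where "dif j = int (U j) - int (V j)"
abbreviation sword :: "nat \<Rightarrow> int" where "sword k \<equiv> signed_take_bit (w - 1) (int k)"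

text \<open>The width assumption gives \<open>N < 2 ^ (w - 1)\<close>, so these numbers fit into
  \<open>w\<close> bits with sign.\<close>

lemma sword_mod:
  assumes "- int N \<le> z" "z \<le> int N"
  shows "signed_take_bit (w - 1) (z mod 2 ^ w) = z"
proof -
  have "signed_take_bit (w - 1) (take_bit w z) = signed_take_bit (w - 1) z"
    using w_pos by (simp add: signed_take_bit_take_bit)
  also have "\<dots> = z"
  proof -
    have "(2::nat) ^ w = 2 * 2 ^ (w - 1)" using w_pos by (cases w) auto
    then have "N < 2 ^ (w - 1)" using width r_pos r_le_N by linarith
    then have "int N < int (2 ^ (w - 1))" by (simp only: of_nat_less_iff)
    then have "int N < 2 ^ (w - 1)" by (simp only: of_nat_power of_nat_numeral)
    then have "- (2 ^ (w - 1)) \<le> z" "z < 2 ^ (w - 1)" using assms by linarith+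
    then show ?thesis by (rule signed_take_bit_int_eq_self)
  qed
  finally show ?thesis by (simp add: take_bit_eq_mod)
qed

lemma int_K: "j < r \<Longrightarrow> int (K j) = dif j mod 2 ^ w"
proof -
  assume j: "j < r"
  then have "V j \<le> 2 ^ w" using UV_range[of j] width by linarith
  then have "int (K j) = (int (U j) + (2 ^ w - int (V j))) mod 2 ^ w"
    by (simp add: K_def alu.simps(2) zmod_int of_nat_diff add_diff_eq)
  also have "\<dots> = (dif j + 2 ^ w) mod 2 ^ w" by (simp add: dif_def algebra_simps)
  finally show ?thesis by simp
qed

text \<open>The strict upper bound, due to \<open>1 \<le> V j\<close>, keeps the appended value
  \<open>N\<close> apart from all keys of the table.\<close>

lemma dif_range: "j < r \<Longrightarrow> - int N \<le> dif j \<and> dif j < int N"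
  using UV_range[of j] by (auto simp: dif_def)

lemma sword_K: "j < r \<Longrightarrow> sword (K j) = dif j"
  using sword_mod[of "dif j"] dif_range[of j] int_K[of j] by simp

lemma sword_N: "sword N = int N"
proof -
  have "N < 2 ^ w" using width r_pos r_le_N by linarith
  then have "int N mod 2 ^ w = int N" by (simp flip: of_nat_mod of_nat_power)
  then show ?thesis using sword_mod[of "int N"] by simp
qed

text \<open>Decoding inverts the encoding on this range, so merging equal words merges exactly the
  equal differences.\<close>

lemma K_eq_iff: "i < r \<Longrightarrow> j < r \<Longrightarrow> K i = K j \<longleftrightarrow> dif i = dif j"
  using sword_K int_K by (metis of_nat_eq_iff)

definition histogram :: "(int \<times> nat) set" where
  "histogram = insert (int N, 1)
     ((\<lambda>v. (v, \<Sum>j<r - 1. if dif j = v then C j else 0)) ` dif ` {..<r - 1})"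

lemma output_final:
  assumes inv: "loop_inv h (r - 1) E M"
    and M': "mem c = M(2 * length E + 2 := 1, 2 * length E + 1 := N, 0 := length E + 1)"
  shows "distinct (output_pairs w c)" "set (output_pairs w c) = histogram"
proof -
  have entries: "entries r h M E" and dist: "distinct (map fst E)"
    and keys: "fst ` set E = K ` {..<r - 1}"
    and vals: "\<And>e. e \<in> set E \<Longrightarrow> snd e = (\<Sum>j<r - 1. if K j = fst e then C j else 0)"
    using inv unfolding loop_inv_def by blast+
  \<comment> \<open>The output lists the oldest entry first, so the appended pair comes
    last.\<close>
  have "output_pairs w c = map (\<lambda>(k, m). (sword k, m)) (rev ((N, 1) # E))"
  proof (rule nth_equalityI)
    show "length (output_pairs w c) = length (map (\<lambda>(k, m). (sword k, m)) (rev ((N, 1) # E)))"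
      by (simp add: output_pairs_def M' del: upt_Suc)
    fix j assume "j < length (output_pairs w c)"
    then have j: "j < length E + 1" by (simp add: output_pairs_def M' del: upt_Suc)
    then show "output_pairs w c ! j = map (\<lambda>(k, m). (sword k, m)) (rev ((N, 1) # E)) ! j"
      using entries_nth[OF entries, of j]
      by (cases "j = length E") (auto simp: output_pairs_def M' nth_append simp del: upt_Suc split: prod.splits)
  qed
  then have out: "output_pairs w c = rev ((int N, 1) # map (\<lambda>(k, m). (sword k, m)) E)"
    using sword_N by (simp add: rev_map)
  have elem: "(sword (fst e), snd e) \<in> histogram \<and> sword (fst e) \<noteq> int N" if e: "e \<in> set E" for e
  proof -
    obtain i where i: "i < r - 1" "fst e = K i" using e keys by (metis imageE imageI lessThan_iff)
    then have ir: "i < r" by linarith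
    have "snd e = (\<Sum>j<r - 1. if dif j = dif i then C j else 0)"
      unfolding vals[OF e] i(2) using i K_eq_iff by (intro sum.cong) auto
    moreover have "sword (fst e) = dif i" "dif i \<noteq> int N"
      using i(2) sword_K[OF ir] dif_range[OF ir] by simp_all
    ultimately show ?thesis using i by (auto simp: histogram_def)
  qed
  have "inj_on (\<lambda>e. sword (fst e)) (set E)"
  proof (rule inj_onI)
    fix e f assume ef: "e \<in> set E" "f \<in> set E" "sword (fst e) = sword (fst f)"
    obtain i where i: "i < r - 1" "fst e = K i" using ef keys by (metis imageE imageI lessThan_iff)
    obtain j where j: "j < r - 1" "fst f = K j" using ef keys by (metis imageE imageI lessThan_iff)
    have "i < r" "j < r" using i(1) j(1) by linarith+
    then have "fst e = fst f" using i(2) j(2) ef(3) K_eq_iff[of i j] sword_K[of i] sword_K[of j] by simp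
    then show "e = f" using dist ef by (meson eq_key_imp_eq_value distinct_map inj_onD)
  qed
  moreover have "distinct E" using dist by (simp add: distinct_map)
  ultimately have "distinct (map fst (map (\<lambda>(k, m). (sword k, m)) E))"
    by (simp add: distinct_map comp_def case_prod_beta)
  moreover have "int N \<notin> set (map fst (map (\<lambda>(k, m). (sword k, m)) E))"
    using elem by force
  ultimately have "distinct (map fst (output_pairs w c))"
    by (simp only: out rev_map[symmetric] distinct_rev list.map distinct.simps fst_conv simp_thms)
  then show "distinct (output_pairs w c)" by (simp add: distinct_map)
  show "set (output_pairs w c) = histogram"
  proof
    show "set (output_pairs w c) \<subseteq> histogram"
      unfolding out using elem by (fastforce simp: histogram_def)
    show "histogram \<subseteq> set (output_pairs w c)"
    proof
      fix p assume p: "p \<in> histogram"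
      show "p \<in> set (output_pairs w c)"
      proof (cases "p = (int N, 1)")
        case True
        then show ?thesis unfolding out by simp
      next
        case False
        then obtain i where i: "i < r - 1" "p = (dif i, \<Sum>j<r - 1. if dif j = dif i then C j else 0)"
          using p by (auto simp: histogram_def)
        then have ir: "i < r" by linarith
        have "K i \<in> fst ` set E" using keys i by auto
        then obtain e where e: "e \<in> set E" "fst e = K i" by force
        have "snd e = (\<Sum>j<r - 1. if dif j = dif i then C j else 0)"
          unfolding vals[OF e(1)] e(2) using i K_eq_iff by (intro sum.cong) auto
        then have "p = (\<lambda>(k, m). (sword k, m)) e" using i(2) e(2) sword_K[OF ir] by (cases e) simp
        then show ?thesis unfolding out using e(1) by auto
      qed
    qed
  qed
qed

end

lemma length_encode_pairs: "length (encode_pairs ps) = 2 * length ps + 1"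
  by (induction ps) (auto simp: encode_pairs_def)

lemma encode_pairs_nth:
  assumes "j < length ps"
  shows "encode_pairs ps ! (2 * j + 1) = fst (ps ! j)" "encode_pairs ps ! (2 * j + 2) = snd (ps ! j)"
  using assms
proof (induction ps arbitrary: j)
  case (Cons p ps)
  { case 1 then show ?case using Cons.IH(1)[of "j - 1"]
      by (cases j; cases p) (auto simp: encode_pairs_def)
  next
    case 2 then show ?case using Cons.IH(2)[of "j - 1"]
      by (cases j; cases p) (auto simp: encode_pairs_def) }
qed simp_all

section \<open>Expected running time\<close>

lemma nn_integral_uniform_count_measure:
  assumes "finite A" "A \<noteq> {}"
  shows "(\<integral>\<^sup>+ x. f x \<partial>uniform_count_measure A) = (\<Sum>x\<in>A. f x) / of_nat (card A)"
proof -
  have "0 < card A" using assms by (simp add: card_gt_0_iff)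
  then have "ennreal (1 / real (card A)) = inverse (of_nat (card A))"
    by (simp add: inverse_eq_divide ennreal_of_nat_eq_real_of_nat inverse_ennreal flip: inverse_eq_divide)
  then show ?thesis
    using assms(1) unfolding uniform_count_measure_def
    by (simp add: nn_integral_point_measure_finite divide_ennreal_def mult.commute flip: sum_distrib_right)
qed

lemma (in prob_space) nn_integral_stream_space_shd:
  assumes [measurable]: "f \<in> borel_measurable M"
  shows "(\<integral>\<^sup>+ \<omega>. f (shd \<omega>) \<partial>stream_space M) = (\<integral>\<^sup>+ x. f x \<partial>M)"
proof -
  interpret S: prob_space "stream_space M" by (rule prob_space_stream_space)
  show ?thesis by (subst nn_integral_stream_space) (simp_all add: S.emeasure_space_1)
qed

context histogram_input
begin

text \<open>For \<open>1 < r\<close> the addition does not overflow, and \<open>D\<close> is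
  \<open>2 ^ w / r\<close> rounded up.\<close>

lemma D_eq: "1 < r \<Longrightarrow> D = (2 ^ w - 1) div r + 1"
proof -
  assume r: "1 < r"
  have "(2 ^ w - 1) div r < 2 ^ w - (1::nat)"
    using r r_width by (intro div_less_dividend) auto
  then show ?thesis unfolding D_def by (simp add: alu_Add)
qed

text \<open>Because of the rounding up, \<open>r * D\<close> exceeds every word.\<close>

lemma hash_less:
  assumes "1 < r" shows "hash w D a x < r"
proof -
  have "y div D < r" if "y < 2 ^ w" for y
  proof -
    have "y \<le> 2 ^ w - 1" using that by simp
    also have "\<dots> = r * ((2 ^ w - 1) div r) + (2 ^ w - 1) mod r" by simp
    also have "\<dots> < r * ((2 ^ w - 1) div r) + r" using assms by (intro add_strict_left_mono) simp
    also have "\<dots> = r * D" using D_eq[OF assms] by simp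
    finally show ?thesis by (rule less_mult_imp_div_less)
  qed
  then show ?thesis by (simp add: hash_def)
qed

text \<open>The 20 is made up of 12 initial and 8 final instructions.\<close>

definition time_bound :: "nat \<Rightarrow> nat" where
  "time_bound a = 20 + (\<Sum>i<r - 1. 23 + 8 * collisions (hash w D a) i)"

lemma initial_config_st:
  "initial_config ps \<omega> = st 0 [0,0,0,0,0,0,0,0,0,0,0,0,0,0,0,0,0]
     (\<lambda>a. if a < length (encode_pairs ps) then encode_pairs ps ! a else 0) \<omega>"
proof -
  have "[0,0,0,0,0,0,0,0,0,0,0,0,0,0,0,0,0] = replicate 17 (0::nat)"
    by (simp add: numeral_eq_Suc)
  then show ?thesis unfolding initial_config_def st_def by (auto simp: fun_eq_iff)
qed

theorem exec_prog:
  "\<exists>t c. t \<le> time_bound (shd \<omega>) \<and> exec w prog (6 * r) t (initial_config ps \<omega>) c \<and> halted prog c \<and>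
     distinct (output_pairs w c) \<and> set (output_pairs w c) = histogram"
proof -
  let ?M = "\<lambda>a. if a < length (encode_pairs ps) then encode_pairs ps ! a else 0"
  let ?h = "hash w D (shd \<omega>)"
  have "?M 0 = r" by (simp add: encode_pairs_def r_def)
  then obtain c0 where c0: "exec w prog (6 * r) 12 (initial_config ps \<omega>) c0"
      "at_loop (shd \<omega> OR 1) 0 0 ?M (stl \<omega>) c0"
    using exec_init[of ?M \<omega>] unfolding initial_config_st by blast
  \<comment> \<open>The cells behind the input are initially 0, so all buckets are empty without
    being cleared.\<close>
  have inv: "loop_inv ?h 0 [] ?M"
    unfolding loop_inv_def using encode_pairs_nth[of _ ps]
    by (auto simp: length_encode_pairs U_def V_def r_def)
  obtain t E M c1 where t: "t \<le> (\<Sum>j<r - 1. 23 + 8 * collisions ?h j)" "loop_inv ?h (r - 1) E M"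
    "at_loop (shd \<omega> OR 1) (r - 1) (length E) M (stl \<omega>) c1" "exec w prog (6 * r) t c0 c1"
    using loop_iterate[OF inv c0(2), of "r - 1"] hash_less r_pos by (auto simp: hash_def alu.simps)
  let ?M' = "M(2 * length E + 2 := 1, 2 * length E + 1 := N, 0 := length E + 1)"
  obtain xs where f: "exec w prog (6 * r) 8 c1 (st 53 xs ?M' (stl \<omega>))"
    using exec_final[OF t(3,2)] by blast
  have "exec w prog (6 * r) (12 + (t + 8)) (initial_config ps \<omega>) (st 53 xs ?M' (stl \<omega>))"
    using exec_trans[OF c0(1) exec_trans[OF t(4) f]] .
  moreover have "12 + (t + 8) \<le> time_bound (shd \<omega>)" using t(1) by (simp add: time_bound_def)
  moreover have "halted prog (st 53 xs ?M' (stl \<omega>))" by (simp add: halted_def length_prog)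
  moreover have "mem (st 53 xs ?M' (stl \<omega>)) = ?M'" by (simp add: st_def)
  ultimately show ?thesis using output_final[OF t(2)] by blast
qed

text \<open>After exchanging the sums, \<open>K i\<close> meets itself for all \<open>2 ^ w\<close>
  words, and each of the at most \<open>r\<close> other keys for at most \<open>4 * D\<close> of
  them. With \<open>r * D \<le> 2 * 2 ^ w\<close> this adds up to a factor
  \<open>1 + 8\<close>.\<close>

lemma sum_collisions:
  assumes i: "i < r - 1"
  shows "(\<Sum>a<2 ^ w. collisions (hash w D a) i) \<le> 9 * 2 ^ w"
proof -
  let ?S = "K ` {..<r - 1}"
  have r: "1 < r" using i by simp
  have K: "k < 2 ^ w" if "k \<in> ?S" for k using that by (auto simp: K_def alu.simps)
  have "(\<Sum>a<2 ^ w. collisions (hash w D a) i)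
      = (\<Sum>a<2 ^ w. \<Sum>k\<in>?S. if hash w D a k = hash w D a (K i) then 1 else 0)"
    by (simp add: collisions_def sum.If_cases Int_def)
  also have "\<dots> = (\<Sum>k\<in>?S. \<Sum>a<2 ^ w. if hash w D a k = hash w D a (K i) then 1 else 0)"
    by (rule sum.swap)
  also have "\<dots> = (\<Sum>k\<in>?S. card {a. a < 2 ^ w \<and> hash w D a k = hash w D a (K i)})"
    by (simp add: sum.If_cases Int_def)
  also have "\<dots> = card {a. a < 2 ^ w \<and> hash w D a (K i) = hash w D a (K i)}
      + (\<Sum>k\<in>?S - {K i}. card {a. a < 2 ^ w \<and> hash w D a k = hash w D a (K i)})"
    using i by (intro sum.remove) auto
  also have "\<dots> \<le> 2 ^ w + (\<Sum>k\<in>?S - {K i}. 4 * D)"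
    using i K D_eq[OF r] by (intro add_mono sum_mono card_hash_collide) (auto simp: lessThan_def[symmetric])
  also have "\<dots> \<le> 2 ^ w + r * (4 * D)"
  proof -
    have "card (?S - {K i}) \<le> card ?S" by (intro card_mono) auto
    also have "\<dots> \<le> r - 1" using card_image_le[of "{..<r - 1}" K] by simp
    finally have "card (?S - {K i}) \<le> r" by simp
    then have "card (?S - {K i}) * (4 * D) \<le> r * (4 * D)" by (rule mult_le_mono1)
    then show ?thesis by simp
  qed
  also have "\<dots> \<le> 9 * 2 ^ w"
  proof -
    \<comment> \<open>Rounding up to \<open>D\<close> adds at most \<open>r\<close> to the product,
      and \<open>r\<close> is less than \<open>2 ^ w\<close>.\<close>
    have "r * D = r * ((2 ^ w - 1) div r) + r" using D_eq[OF r] by simp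
    also have "\<dots> \<le> (2 ^ w - 1) + r" by (intro add_right_mono times_div_less_eq_dividend)
    also have "\<dots> \<le> 2 * 2 ^ w" using r_width by linarith
    finally show ?thesis by simp
  qed
  finally show ?thesis .
qed

text \<open>Each iteration averages at most \<open>23 + 8 * 9 = 95\<close> steps, and
  \<open>20 + 95 * (r - 1) \<le> 115 * r\<close>.\<close>

lemma sum_time_bound: "(\<Sum>a<2 ^ w. time_bound a) \<le> 115 * r * 2 ^ w"
proof -
  have "(\<Sum>a<2 ^ w. time_bound a)
      = 20 * 2 ^ w + (\<Sum>i<r - 1. 23 * 2 ^ w + 8 * (\<Sum>a<2 ^ w. collisions (hash w D a) i))"
  proof -
    have "(\<Sum>a<2 ^ w. \<Sum>i<r - 1. collisions (hash w D a) i)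
        = (\<Sum>i<r - 1. \<Sum>a<2 ^ w. collisions (hash w D a) i)"
      by (rule sum.swap)
    then show ?thesis by (simp add: time_bound_def sum.distrib flip: sum_distrib_left)
  qed
  also have "\<dots> \<le> 20 * 2 ^ w + (\<Sum>i<r - 1. 95 * 2 ^ w)"
    using sum_collisions by (intro add_left_mono sum_mono) fastforce
  also have "\<dots> = (20 + 95 * (r - 1)) * 2 ^ w" by (simp add: algebra_simps)
  also have "\<dots> \<le> 115 * r * 2 ^ w" using r_pos by (intro mult_right_mono) auto
  finally show ?thesis .
qed

text \<open>The time bound depends on the first random word only, so the integral over tapes reduces
  to an average over \<open>2 ^ w\<close> words.\<close>

theorem expected_running_time:
  "(\<integral>\<^sup>+ \<omega>. running_time w prog (initial_config ps \<omega>) \<partial>random_tapes w) \<le> of_nat (115 * r)"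
proof -
  let ?M = "uniform_count_measure {..<2 ^ w :: nat}"
  interpret prob_space ?M by (rule prob_space_uniform_count_measure) (auto simp: lessThan_empty_iff)
  have "running_time w prog (initial_config ps \<omega>) \<le> of_nat (time_bound (shd \<omega>))" for \<omega>
  proof -
    obtain t c where "t \<le> time_bound (shd \<omega>)" "exec w prog (6 * r) t (initial_config ps \<omega>) c" "halted prog c"
      using exec_prog by blast
    then show ?thesis using exec_halted(3) by (meson of_nat_mono order_trans)
  qed
  then have "(\<integral>\<^sup>+ \<omega>. running_time w prog (initial_config ps \<omega>) \<partial>random_tapes w)
      \<le> (\<integral>\<^sup>+ \<omega>. of_nat (time_bound (shd \<omega>)) \<partial>random_tapes w)"
    by (intro nn_integral_mono)
  also have "\<dots> = (\<integral>\<^sup>+ a. of_nat (time_bound a) \<partial>?M)"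
    unfolding random_tapes_def
    by (rule nn_integral_stream_space_shd) (simp add: measurable_def sets_uniform_count_measure space_uniform_count_measure)
  also have "\<dots> = of_nat (\<Sum>a<2 ^ w. time_bound a) / of_nat (2 ^ w)"
    by (subst nn_integral_uniform_count_measure) (simp_all add: lessThan_empty_iff)
  also have "\<dots> \<le> of_nat (115 * r * 2 ^ w) / of_nat (2 ^ w)"
    using sum_time_bound by (intro divide_right_mono_ennreal of_nat_mono)
  also have "\<dots> = of_nat (115 * r)"
    unfolding of_nat_mult[of "115 * r"]
    by (rule mult_divide_eq_ennreal) (simp, simp add: power_eq_top_ennreal)
  finally show ?thesis .
qed

end

section \<open>The program applied to a text\<close>

lemma (in suffix_sorted) histogram_input_I_Phi:
  assumes "32 * n \<le> 2 ^ w"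
  shows "histogram_input (I_Phi T) n w"
proof
  have fst: "map fst (I_Phi T) = us" by (simp add: I_Phi_def comp_def)
  have ne: "us \<noteq> []" using r_pos length_us by auto
  show "I_Phi T \<noteq> []" using ne by (simp add: I_Phi_def)
  show "sorted_wrt (<) (map fst (I_Phi T))" unfolding fst by (rule sorted_us)
  show "fst (last (I_Phi T)) = n"
    using us_last ne length_us last_conv_nth[of us] by (simp add: I_Phi_def last_map)
  show "1 \<le> u \<and> u \<le> n \<and> 1 \<le> v \<and> v \<le> n" if "(u, v) \<in> set (I_Phi T)" for u v
    using that us_range[of u] Phi_range[of u] by (auto simp: I_Phi_def)
qed (rule assms)

lemma (in suffix_sorted) histogram_I_Phi:
  assumes "32 * n \<le> 2 ^ w"
  shows "histogram_input.r (I_Phi T) = num_runs T"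
    and "histogram_input.histogram (I_Phi T) n =
      (\<lambda>v. (v, count_list (diff_suffix_array T) v)) ` set (diff_suffix_array T)"
proof -
  interpret H: histogram_input "I_Phi T" n w by (rule histogram_input_I_Phi[OF assms])
  show r: "H.r = r" unfolding H.r_def by (simp add: I_Phi_def length_us)
  have U: "H.U j = us ! j" if "j < r" for j using that length_us unfolding H.U_def by (simp add: I_Phi_def)
  have dif: "H.dif j = d (us ! j)" if "j < r" for j
    using that length_us U[of j] unfolding H.dif_def H.V_def by (simp add: d_def I_Phi_def)
  have C: "H.C j = us ! (j + 1) - us ! j" if "j < r - 1" for j
    using that U[of j] U[of "Suc j"] by (simp add: H.C_def)
  have count: "count_list (diff_suffix_array T) v =
      (if v = int n then 1 else 0) + (\<Sum>j<r - 1. if H.dif j = v then H.C j else 0)" for v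
    unfolding count_diff_suffix_array using dif C by (intro arg_cong2[where f = "(+)"] sum.cong) auto
  \<comment> \<open>Hence the value \<open>n\<close> comes from the first entry of
    \<open>A\<^sup>d\<close> alone and has multiplicity 1.\<close>
  have ne: "H.dif j \<noteq> int n" if "j < r - 1" for j
  proof -
    have "j < H.r" using that r by linarith
    then show ?thesis using H.dif_range[of j] by simp
  qed
  have "(\<lambda>i. d (us ! i)) ` {..<r - 1} = H.dif ` {..<r - 1}" using dif by (intro image_cong) auto
  then have set: "set (diff_suffix_array T) = insert (int n) (H.dif ` {..<r - 1})"
    by (simp add: set_diff_suffix_array)
  show "H.histogram = (\<lambda>v. (v, count_list (diff_suffix_array T) v)) ` set (diff_suffix_array T)"
    unfolding H.histogram_def set image_insert r
  proof (intro arg_cong2[where f = insert] image_cong refl)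
    have "(\<Sum>j<r - 1. if H.dif j = int n then H.C j else 0) = 0" using ne by simp
    then show "(int n, 1) = (int n, count_list (diff_suffix_array T) (int n))" by (simp add: count)
  next
    fix v assume "v \<in> H.dif ` {..<r - 1}"
    then have "v \<noteq> int n" using ne by auto
    then show "(v, \<Sum>j<r - 1. if H.dif j = v then H.C j else 0) = (v, count_list (diff_suffix_array T) v)"
      by (simp add: count)
  qed
qed

theorem theorem2:
  shows "(\<exists>(P :: instr list) (\<kappa> :: nat) (c :: nat) (s :: nat).
            \<forall>(T :: 'a::linorder list) (w :: nat).
              sentinel_terminated T \<longrightarrow> \<kappa> * length T \<le> 2 ^ w \<longrightarrow>
              (\<forall>\<omega> \<in> space (random_tapes w).
                 runs_in_space w P (initial_config (I_Phi T) \<omega>) (s * num_runs T)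
                 \<and> (\<forall>t. halted P (run w P (initial_config (I_Phi T) \<omega>) t) \<longrightarrow>
                      distinct (output_pairs w (run w P (initial_config (I_Phi T) \<omega>) t))
                      \<and> set (output_pairs w (run w P (initial_config (I_Phi T) \<omega>) t)) =
                        (\<lambda>v. (v, count_list (diff_suffix_array T) v)) ` set (diff_suffix_array T)))
              \<and> (\<integral>\<^sup>+ \<omega>. running_time w P (initial_config (I_Phi T) \<omega>) \<partial>random_tapes w)
                  \<le> of_nat (c * num_runs T))
       \<and> (\<forall>T :: 'a list. sentinel_terminated T \<longrightarrow>
            card (set (diff_suffix_array T)) \<le> num_runs T + 1)"
proof (rule conjI, goal_cases)
  case 1
  \<comment> \<open>The witnesses: 32 is the width factor of \<open>histogram_input\<close> and 115
    the average time per run. Space 6 per run suffices because the highest cells are links, which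
    end at \<open>4 * r\<close>.\<close>
  show ?case
  proof (rule exI[of _ prog], rule exI[of _ 32], rule exI[of _ 115], rule exI[of _ 6],
      intro allI impI conjI ballI)
    fix T :: "'a list" and w :: nat
    assume T: "sentinel_terminated T" and w: "32 * length T \<le> 2 ^ w"
    interpret suffix_sorted T by unfold_locales (rule T)
    interpret H: histogram_input "I_Phi T" "length T" w by (rule histogram_input_I_Phi[OF w])
    show "(\<integral>\<^sup>+ \<omega>. running_time w prog (initial_config (I_Phi T) \<omega>) \<partial>random_tapes w)
        \<le> of_nat (115 * num_runs T)"
      using H.expected_running_time unfolding histogram_I_Phi[OF w] .
    fix \<omega>
    obtain t c where tc: "exec w prog (6 * num_runs T) t (initial_config (I_Phi T) \<omega>) c" "halted prog c"
        "distinct (output_pairs w c)"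
        "set (output_pairs w c) = (\<lambda>v. (v, count_list (diff_suffix_array T) v)) ` set (diff_suffix_array T)"
      using H.exec_prog[of \<omega>] unfolding histogram_I_Phi[OF w] by blast
    show "runs_in_space w prog (initial_config (I_Phi T) \<omega>) (6 * num_runs T)"
      using exec_halted(1)[OF tc(1,2)] .
    fix s assume "halted prog (run w prog (initial_config (I_Phi T) \<omega>) s)"
    then have "run w prog (initial_config (I_Phi T) \<omega>) s = c" by (rule exec_halted(2)[OF tc(1,2)])
    then show "distinct (output_pairs w (run w prog (initial_config (I_Phi T) \<omega>) s))"
      and "set (output_pairs w (run w prog (initial_config (I_Phi T) \<omega>) s)) =
        (\<lambda>v. (v, count_list (diff_suffix_array T) v)) ` set (diff_suffix_array T)"
      using tc(3,4) by simp_all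
  qed
next
  case 2
  show ?case
  proof (intro allI impI)
    fix T :: "'a list"
    assume "sentinel_terminated T"
    then interpret suffix_sorted T by unfold_locales
    show "card (set (diff_suffix_array T)) \<le> num_runs T + 1" by (rule card_diff_suffix_array)
  qed
qed

end
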